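(* Suppose $X$ satisfies condition (A) on $T$ (see context), and let $Q:=\sum_{j=1}^N(1/H_j)$. Then there exist positive constants $C$ and $C'$ such that for any $t\in T$, \[ \liminf_{r\to0}\ \sup_{s\in B_\rho(t,r)}\frac{|X(s)-X(t)|}{r(\log\log(1/r))^{-1/Q}}\ge C\quad\text{a.s.} \] and \[ \liminf_{r\to0}\ \inf_{t\in T}\ \sup_{s\in B_\rho(t,r)}\frac{|X(s)-X(t)|}{r(\log(1/r))^{-1/Q}}\ge C'\quad\text{a.s.} \] In particular, the sample paths of $X$ are a.s. nowhere differentiable in $T$.
   Context: $N,d\ge1$ are integers. $X=\{X(t),t\in\mathbb{R}^N\}$, $X(t)=(X_1(t),\dots,X_d(t))$, is a mean zero continuous Gaussian random field with values in $\mathbb{R}^d$, where $X_1,\dots,X_d$ are i.i.d. copies of a real-valued Gaussian field $Y=\{Y(t),t\in\mathbb{R}^N\}$. $T$ is a closed (or open) bounded interval (rectangle with nonempty interior) in $\mathbb{R}^N$. **Condition (A) on $T$.** There is a constant vector $H=(H_1,\dots,H_N)\in(0,1)^N$ such that, with $\rho(t,s)=\sum_{j=1}^N|t_j-s_j|^{H_j}$: (A1) there are constants $0<C_1\le C_2<\infty$ with $C_1\rho^2(t,s)\le\mathbb{E}[(Y(t)-Y(s))^2]\le C_2\rho^2(t,s)$ for all $t,s\in T$; (A2) there is a constant $C_3>0$ such that for all integers $n\ge1$ and all $t,t^1,\dots,t^n\in T$, $\mathrm{Var}(Y(t)\,|\,Y(t^1),\dots,Y(t^n))\ge C_3\min_{0\le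 k\le n}\rho^2(t,t^k)$, where $t^0=0$. $B_\rho(a,r)=\{t\in\mathbb{R}^N:\rho(t,a)\le r\}$. *)

theory Defs
  imports "HOL-Probability.Probability"
begin

text \<open>The variance \<open>\<sigma>\<^sup>2\<close> may vanish, so that constants count as Gaussian.\<close>

definition gaussian_rv :: "'a measure \<Rightarrow> ('a \<Rightarrow> real) \<Rightarrow> bool" where
  "gaussian_rv M Z \<longleftrightarrow> Z \<in> borel_measurable M \<and>
     (\<exists>\<mu> \<sigma>. \<sigma> \<ge> 0 \<and>
        distr M borel Z =
          (if \<sigma> = 0 then return borel \<mu>
           else density lborel (\<lambda>x. ennreal (normal_density \<mu> \<sigma> x))))"

definition gaussian_field ::
    "'a measure \<Rightarrow> ('t \<Rightarrow> 'a \<Rightarrow> 'v::euclidean_space) \<Rightarrow> bool" where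
  "gaussian_field M X \<longleftrightarrow> prob_space M \<and> (\<forall>t. X t \<in> borel_measurable M) \<and>
     (\<forall>S c. finite S \<longrightarrow> gaussian_rv M (\<lambda>\<omega>. \<Sum>t\<in>S. c t \<bullet> X t \<omega>))"

definition mean_zero_field ::
    "'a measure \<Rightarrow> ('t \<Rightarrow> 'a \<Rightarrow> 'v::euclidean_space) \<Rightarrow> bool" where
  "mean_zero_field M X \<longleftrightarrow> (\<forall>t. (\<integral>\<omega>. X t \<omega> \<partial>M) = 0)"

definition continuous_field ::
    "'a measure \<Rightarrow> ('t::topological_space \<Rightarrow> 'a \<Rightarrow> 'v::euclidean_space) \<Rightarrow> bool" where
  "continuous_field M X \<longleftrightarrow> (AE \<omega> in M. continuous_on UNIV (\<lambda>t. X t \<omega>))"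

text \<open>The components of \<open>X\<close> are independent as random elements of the space of all functions
  \<open>'t \<Rightarrow> real\<close> with its product sigma-algebra, and each of them has there the law of \<open>Y\<close>.
  The field \<open>Y\<close> may live on a probability space of its own.\<close>

definition iid_copies ::
    "'a measure \<Rightarrow> ('t \<Rightarrow> 'a \<Rightarrow> real ^ 'd) \<Rightarrow> 'b measure \<Rightarrow> ('t \<Rightarrow> 'b \<Rightarrow> real) \<Rightarrow> bool" where
  "iid_copies M X M' Y \<longleftrightarrow>
     prob_space.indep_vars M (\<lambda>i. \<Pi>\<^sub>M t\<in>UNIV. borel) (\<lambda>i \<omega> t. X t \<omega> $ i) UNIV \<and>
     (\<forall>i. distr M (\<Pi>\<^sub>M t\<in>UNIV. borel) (\<lambda>\<omega> t. X t \<omega> $ i) =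
          distr M' (\<Pi>\<^sub>M t\<in>UNIV. borel) (\<lambda>\<omega> t. Y t \<omega>))"

definition rho :: "real ^ 'n \<Rightarrow> real ^ 'n \<Rightarrow> real ^ 'n \<Rightarrow> real" where
  "rho H t s = (\<Sum>j\<in>UNIV. \<bar>t $ j - s $ j\<bar> powr (H $ j))"

definition B_rho :: "real ^ 'n \<Rightarrow> real ^ 'n \<Rightarrow> real \<Rightarrow> (real ^ 'n) set" where
  "B_rho H a r = {t. rho H t a \<le> r}"

definition bounded_interval :: "(real ^ 'n) set \<Rightarrow> bool" where
  "bounded_interval T \<longleftrightarrow> (\<exists>a b. (\<forall>j. a $ j < b $ j) \<and> (T = cbox a b \<or> T = box a b))"

text \<open>The sigma-algebra generated by \<open>Z 1, \<dots>, Z n\<close>.\<close>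

definition generated_algebra :: "'a measure \<Rightarrow> nat \<Rightarrow> (nat \<Rightarrow> 'a \<Rightarrow> real) \<Rightarrow> 'a measure" where
  "generated_algebra M n Z =
     vimage_algebra (space M) (\<lambda>\<omega>. \<lambda>k\<in>{1..n}. Z k \<omega>) (\<Pi>\<^sub>M k\<in>{1..n}. borel)"

definition cond_variance :: "'a measure \<Rightarrow> 'a measure \<Rightarrow> ('a \<Rightarrow> real) \<Rightarrow> 'a \<Rightarrow> real" where
  "cond_variance M F Z = real_cond_exp M F (\<lambda>\<omega>. (Z \<omega> - real_cond_exp M F Z \<omega>)\<^sup>2)"

text \<open>The conditional variance is a random variable that is determined up to null sets (for
  Gaussian fields it is almost surely constant), so its lower bound is an almost sure one.\<close>

definition condition_A ::
    "'a measure \<Rightarrow> (real ^ 'n \<Rightarrow> 'a \<Rightarrow> real) \<Rightarrow> real ^ 'n \<Rightarrow> (real ^ 'n) set \<Rightarrow> bool" where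
  "condition_A M Y H T \<longleftrightarrow>
     (\<forall>j. 0 < H $ j \<and> H $ j < 1) \<and>
     (\<exists>C1 C2. 0 < C1 \<and> C1 \<le> C2 \<and>
        (\<forall>t\<in>T. \<forall>s\<in>T. C1 * (rho H t s)\<^sup>2 \<le> (\<integral>\<omega>. (Y t \<omega> - Y s \<omega>)\<^sup>2 \<partial>M) \<and>
                     (\<integral>\<omega>. (Y t \<omega> - Y s \<omega>)\<^sup>2 \<partial>M) \<le> C2 * (rho H t s)\<^sup>2)) \<and>
     (\<exists>C3>0. \<forall>n\<ge>1. \<forall>t\<in>T. \<forall>\<tau>::nat \<Rightarrow> real ^ 'n. \<tau> 0 = 0 \<longrightarrow> (\<forall>k\<in>{1..n}. \<tau> k \<in> T) \<longrightarrow>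
        (AE \<omega> in M.
           cond_variance M (generated_algebra M n (\<lambda>k. Y (\<tau> k))) (Y t) \<omega>
             \<ge> C3 * (MIN k\<in>{0..n}. (rho H t (\<tau> k))\<^sup>2)))"

end

theory Submission
  imports Defs "HOL-Real_Asymp.Real_Asymp"
begin

text \<open>Since \<open>|X| \<ge> |X\<^sub>i|\<close>, one component suffices. Condition (A2) bounds from below the \<open>L\<^sup>2\<close> distance
  of \<open>Y(s\<^sub>k)\<close> to the linear span of \<open>Y(t), Y(s\<^sub>1), \<dots>, Y(s\<^sub>k\<^sub>-\<^sub>1)\<close>, so \<open>n\<close> points of the ball around \<open>t\<close> that
  are \<open>\<delta>\<close>-separated from each other, from \<open>t\<close> and from \<open>0\<close> satisfy
  \<open>P(max\<^sub>k |Y(s\<^sub>k) - Y(t)| \<le> c \<delta>) \<le> e\<^sup>-\<^sup>n\<close>. A ball of radius \<open>r\<close> contains about \<open>n\<close> such points with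
  \<open>\<delta> \<approx> r n\<^sup>-\<^sup>1\<^sup>/\<^sup>Q\<close>. Along \<open>r = 2\<^sup>-\<^sup>m\<close>, Borel--Cantelli with \<open>n \<approx> log m\<close> gives the pointwise bound; with
  \<open>n \<approx> m\<close> the bound survives a union over a net of \<open>T\<close>, whose size is only exponential in \<open>m\<close>, and
  this gives the uniform one. As every \<open>H\<^sub>j\<close> is below \<open>1\<close>, a differentiable function oscillates
  by \<open>o(r (log (1/r))\<^sup>-\<^sup>1\<^sup>/\<^sup>Q)\<close> on these balls.\<close>

section \<open>Centered Gaussian variables and conditional variance\<close>

text \<open>The bound e^(-n) is a determinant estimate in disguise. The indicator of |w| <= 1 is at
  most e^(1/2) e^(-w^2/2), and for a centered Gaussian vector with nonsingular covariance S the
  product of the factors e^(-w_k^2/2) has expectation det(I + S)^(-1/2) <= det(S)^(-1/2). By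
  Gram-Schmidt, det S is the product of the residual variances of the coordinates given their
  predecessors, and these are what (A2) bounds from below. Neither determinants nor joint or
  conditional Gaussian densities appear: characteristic functions of linear combinations carry the
  argument, and the variables are eliminated one at a time. (A2) also compares with the origin, and
  the increments involve Y(t); hence the separation from 0 and from t, which costs at most two grid
  points. Only finitely many points of each ball enter a probability estimate. The infimum over the
  uncountable set \<open>T\<close> and the limit along continuous \<open>r\<close> are treated path
  by path after Borel-Cantelli, at the price of constant factors.\<close>

lemma gaussian_rv_cases:
  assumes M: "prob_space M" and g: "gaussian_rv M Z"
  obtains (const) \<mu> where "AE \<omega> in M. Z \<omega> = \<mu>"
    | (normal) \<mu> \<sigma> where "0 < \<sigma>" "distributed M lborel Z (normal_density \<mu> \<sigma>)"
proof -
  interpret prob_space M by fact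
  have Z[measurable]: "Z \<in> borel_measurable M" using g by (simp add: gaussian_rv_def)
  obtain \<mu> \<sigma> where s: "\<sigma> \<ge> 0" and d: "distr M borel Z =
          (if \<sigma> = 0 then return borel \<mu>
           else density lborel (\<lambda>x. ennreal (normal_density \<mu> \<sigma> x)))"
    using g unfolding gaussian_rv_def by blast
  show thesis
  proof (cases "\<sigma> = 0")
    case True
    then have eq: "distr M borel Z = return borel \<mu>" using d by simp
    have "AE x in distr M borel Z. x = \<mu>" unfolding eq by (subst AE_return) auto
    then have "AE \<omega> in M. Z \<omega> = \<mu>"
      by (subst (asm) AE_distr_iff) auto
    then show thesis by (rule const)
  next
    case False
    then have "distributed M lborel Z (normal_density \<mu> \<sigma>)"
      using d by (simp add: distributed_def cong: distr_cong)
    then show thesis by (rule normal[rotated]) (use s False in auto)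
  qed
qed

lemma gaussian_rv_integrable:
  assumes M: "prob_space M" and g: "gaussian_rv M Z"
  shows "integrable M Z" and "integrable M (\<lambda>\<omega>. (Z \<omega>)\<^sup>2)"
proof -
  interpret prob_space M by fact
  have Z[measurable]: "Z \<in> borel_measurable M" using g by (simp add: gaussian_rv_def)
  have "integrable M Z \<and> integrable M (\<lambda>\<omega>. (Z \<omega>)\<^sup>2)"
    using M g
  proof (cases rule: gaussian_rv_cases)
    case (const \<mu>)
    have "integrable M Z \<longleftrightarrow> integrable M (\<lambda>_. \<mu>)"
      by (rule integrable_cong_AE) (use const in auto)
    moreover have "integrable M (\<lambda>\<omega>. (Z \<omega>)\<^sup>2) \<longleftrightarrow> integrable M (\<lambda>_. \<mu>\<^sup>2)"
      by (rule integrable_cong_AE) (use const in auto)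
    ultimately show ?thesis by simp
  next
    case (normal \<mu> \<sigma>)
    have 1: "integrable M (\<lambda>\<omega>. Z \<omega> - \<mu>)"
      using integrable_normal_moment[of \<sigma> \<mu> 1] distributed_integrable[OF normal(2), of "\<lambda>x. x - \<mu>"] normal(1)
      by simp
    have 2: "integrable M (\<lambda>\<omega>. (Z \<omega> - \<mu>)\<^sup>2)"
      using integrable_normal_moment[of \<sigma> \<mu> 2] distributed_integrable[OF normal(2), of "\<lambda>x. (x - \<mu>)\<^sup>2"] normal(1)
      by simp
    have "integrable M (\<lambda>\<omega>. (Z \<omega> - \<mu>) + \<mu>)" using 1 by (intro Bochner_Integration.integrable_add) auto
    moreover have "integrable M (\<lambda>\<omega>. (Z \<omega> - \<mu>)\<^sup>2 + 2 * \<mu> * (Z \<omega> - \<mu>) + \<mu>\<^sup>2)"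
      using 1 2 by (intro Bochner_Integration.integrable_add integrable_mult_right) auto
    moreover have "(\<lambda>\<omega>. (Z \<omega> - \<mu>)\<^sup>2 + 2 * \<mu> * (Z \<omega> - \<mu>) + \<mu>\<^sup>2) = (\<lambda>\<omega>. (Z \<omega>)\<^sup>2)"
      by (auto simp: power2_eq_square algebra_simps)
    ultimately show ?thesis by simp
  qed
  then show "integrable M Z" and "integrable M (\<lambda>\<omega>. (Z \<omega>)\<^sup>2)" by auto
qed

text \<open>Dividing by \<open>\<sigma>\<close> reduces to the standard normal law, and the
  degenerate law fits the same formula with variance 0. This formula is all that the small-ball
  estimate will know about Gaussian laws.\<close>

lemma centered_gaussian_char:
  assumes M: "prob_space M" and g: "gaussian_rv M Z" and mean: "(\<integral>\<omega>. Z \<omega> \<partial>M) = 0"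
  shows "(\<integral>\<omega>. iexp (Z \<omega>) \<partial>M) = complex_of_real (exp (- (\<integral>\<omega>. (Z \<omega>)\<^sup>2 \<partial>M) / 2))"
proof -
  interpret prob_space M by fact
  have Z[measurable]: "Z \<in> borel_measurable M" using g by (simp add: gaussian_rv_def)
  show ?thesis using M g
  proof (cases rule: gaussian_rv_cases)
    case (const \<mu>)
    have "(\<integral>\<omega>. Z \<omega> \<partial>M) = (\<integral>\<omega>. \<mu> \<partial>M)"
      by (rule integral_cong_AE) (use const in auto)
    then have mu: "\<mu> = 0" using mean by (simp add: prob_space)
    have "(\<integral>\<omega>. (Z \<omega>)\<^sup>2 \<partial>M) = (\<integral>\<omega>. 0 \<partial>M)"
      by (rule integral_cong_AE) (use const mu in auto)
    moreover have "(\<integral>\<omega>. iexp (Z \<omega>) \<partial>M) = (\<integral>\<omega>. 1 \<partial>M)"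
      by (rule integral_cong_AE) (use const mu in auto)
    ultimately show ?thesis by (simp add: prob_space)
  next
    case (normal \<mu> \<sigma>)
    have mu: "\<mu> = 0" using normal_distributed_expectation[OF normal] mean by simp
    have v: "(\<integral>\<omega>. (Z \<omega>)\<^sup>2 \<partial>M) = \<sigma>\<^sup>2" using normal_distributed_variance[OF normal] mean by simp
    have D: "distributed M lborel (\<lambda>x. Z x / \<sigma>) std_normal_density"
      using normal normal_standard_normal_convert[OF normal(1), of Z \<mu>] mu by simp
    have dd: "distr M borel (\<lambda>x. Z x / \<sigma>) = std_normal_distribution"
      using distributed_distr_eq_density[OF D] by (simp cong: distr_cong)
    have "(\<integral>\<omega>. iexp (Z \<omega>) \<partial>M) = (\<integral>\<omega>. iexp (\<sigma> * (Z \<omega> / \<sigma>)) \<partial>M)" using normal(1) by simp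
    also have "\<dots> = (\<integral>x. iexp (\<sigma> * x) \<partial>distr M borel (\<lambda>x. Z x / \<sigma>))"
      by (subst integral_distr) auto
    also have "\<dots> = char std_normal_distribution \<sigma>" by (simp only: dd char_def)
    finally show ?thesis by (simp add: char_std_normal_distribution v)
  qed
qed

lemma integrable_mult_of_squares:
  fixes f g :: "'a \<Rightarrow> real"
  assumes [measurable]: "f \<in> borel_measurable M" "g \<in> borel_measurable M"
    and "integrable M (\<lambda>\<omega>. (f \<omega>)\<^sup>2)" "integrable M (\<lambda>\<omega>. (g \<omega>)\<^sup>2)"
  shows "integrable M (\<lambda>\<omega>. f \<omega> * g \<omega>)"
proof (rule Bochner_Integration.integrable_bound)
  show "integrable M (\<lambda>\<omega>. (f \<omega>)\<^sup>2 + (g \<omega>)\<^sup>2)" using assms by simp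
  show "AE x in M. norm (f x * g x) \<le> norm ((f x)\<^sup>2 + (g x)\<^sup>2)"
  proof (rule AE_I2)
    fix x
    have "0 \<le> (\<bar>f x\<bar> - \<bar>g x\<bar>)\<^sup>2" by simp
    then have "2 * (\<bar>f x\<bar> * \<bar>g x\<bar>) \<le> (f x)\<^sup>2 + (g x)\<^sup>2"
      by (simp add: power2_diff)
    moreover have "0 \<le> \<bar>f x\<bar> * \<bar>g x\<bar>" by simp
    ultimately show "norm (f x * g x) \<le> norm ((f x)\<^sup>2 + (g x)\<^sup>2)"
      unfolding real_norm_def abs_mult by linarith
  qed
qed measurable

text \<open>Pythagoras: with P the conditional expectation of \<open>Z\<close>, the difference P - L
  is \<open>F\<close>-measurable, hence orthogonal to \<open>Z\<close> - P. So the squared distance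
  from \<open>Z\<close> to \<open>L\<close> is at least that from \<open>Z\<close> to P, which is
  the mean of the conditional variance. This turns (A2) into a bound free of conditioning.\<close>

lemma (in prob_space) integral_square_ge_cond_variance:
  assumes sub: "subalgebra M F"
    and Z[measurable]: "Z \<in> borel_measurable M" and Z2: "integrable M (\<lambda>\<omega>. (Z \<omega>)\<^sup>2)"
    and L[measurable]: "L \<in> borel_measurable F" and L2: "integrable M (\<lambda>\<omega>. (L \<omega>)\<^sup>2)"
    and c: "AE \<omega> in M. c \<le> cond_variance M F Z \<omega>"
  shows "c \<le> (\<integral>\<omega>. (Z \<omega> - L \<omega>)\<^sup>2 \<partial>M)"
proof -
  interpret F: finite_measure_subalgebra M F
    by standard (rule sub)
  have LM[measurable]: "L \<in> borel_measurable M" by (rule measurable_from_subalg[OF sub L])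
  let ?P = "real_cond_exp M F Z"
  have PF[measurable]: "?P \<in> borel_measurable F" by simp
  have PM[measurable]: "?P \<in> borel_measurable M" by simp
  have Z1: "integrable M Z" using square_integrable_imp_integrable[OF Z Z2] .
  have cc: "convex_on UNIV (\<lambda>x::real. x\<^sup>2)"
    by (rule convex_on_realI[where f'="\<lambda>x. 2 * x"]) (auto intro!: derivative_eq_intros)
  \<comment> \<open>Conditional Jensen for the square; the cross terms in the expansions below are
    integrable because of it.\<close>
  have P2: "integrable M (\<lambda>\<omega>. (?P \<omega>)\<^sup>2)"
  proof (rule Bochner_Integration.integrable_bound)
    show "integrable M (real_cond_exp M F (\<lambda>\<omega>. (Z \<omega>)\<^sup>2))" using Z2 by (rule F.real_cond_exp_int)
    have "AE x in M. (?P x)\<^sup>2 \<le> real_cond_exp M F (\<lambda>x. (Z x)\<^sup>2) x"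
      by (rule F.real_cond_exp_jensens_inequality(2)[where I=UNIV and q="\<lambda>x. x\<^sup>2"]) (use Z1 Z2 cc in auto)
    then show "AE x in M. norm ((?P x)\<^sup>2) \<le> norm (real_cond_exp M F (\<lambda>\<omega>. (Z \<omega>)\<^sup>2) x)"
      by eventually_elim auto
  qed measurable
  note [simp] = Z2 L2 P2 integrable_mult_of_squares
  define D where "D = (\<lambda>\<omega>. ?P \<omega> - L \<omega>)"
  have DF[measurable]: "D \<in> borel_measurable F" unfolding D_def by simp
  have [measurable]: "D \<in> borel_measurable M" unfolding D_def by simp
  have D2: "integrable M (\<lambda>\<omega>. (D \<omega>)\<^sup>2)"
  proof -
    have "(\<lambda>\<omega>. (D \<omega>)\<^sup>2) = (\<lambda>\<omega>. (?P \<omega>)\<^sup>2 - 2 * (?P \<omega> * L \<omega>) + (L \<omega>)\<^sup>2)"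
      by (auto simp: D_def power2_eq_square algebra_simps)
    then show ?thesis by simp
  qed
  have E2: "integrable M (\<lambda>\<omega>. (Z \<omega> - ?P \<omega>)\<^sup>2)"
  proof -
    have "(\<lambda>\<omega>. (Z \<omega> - ?P \<omega>)\<^sup>2) = (\<lambda>\<omega>. (Z \<omega>)\<^sup>2 - 2 * (Z \<omega> * ?P \<omega>) + (?P \<omega>)\<^sup>2)"
      by (auto simp: power2_eq_square algebra_simps)
    then show ?thesis by simp
  qed
  note [simp] = D2 E2
  have orth: "(\<integral>\<omega>. D \<omega> * ?P \<omega> \<partial>M) = (\<integral>\<omega>. D \<omega> * Z \<omega> \<partial>M)"
    by (rule F.real_cond_exp_intg) simp_all
  have "c = (\<integral>\<omega>. c \<partial>M)" by (simp add: prob_space)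
  also have "\<dots> \<le> (\<integral>\<omega>. cond_variance M F Z \<omega> \<partial>M)"
    unfolding cond_variance_def
    by (rule integral_mono_AE) (use c E2 in \<open>auto simp: cond_variance_def\<close>)
  also have "\<dots> = (\<integral>\<omega>. (Z \<omega> - ?P \<omega>)\<^sup>2 \<partial>M)"
    unfolding cond_variance_def by (rule F.real_cond_exp_int) simp
  also have "\<dots> \<le> (\<integral>\<omega>. (Z \<omega> - ?P \<omega>)\<^sup>2 \<partial>M) + (\<integral>\<omega>. (D \<omega>)\<^sup>2 \<partial>M)"
    by simp
  also have "\<dots> = (\<integral>\<omega>. (Z \<omega> - ?P \<omega>)\<^sup>2 + (D \<omega>)\<^sup>2 + 2 * (D \<omega> * Z \<omega> - D \<omega> * ?P \<omega>) \<partial>M)"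
    using orth by simp
  also have "\<dots> = (\<integral>\<omega>. (Z \<omega> - L \<omega>)\<^sup>2 \<partial>M)"
    by (rule Bochner_Integration.integral_cong) (auto simp: D_def power2_eq_square algebra_simps)
  finally show ?thesis .
qed

section \<open>Small balls in a Gaussian space\<close>

lemma prob_space_std_normal: "prob_space std_normal_distribution"
  by (rule prob_space_normal_density) simp

text \<open>Replacing the standard normal density by its maximum 1 / sqrt (2 pi) leaves a multiple
  of the normal density with mean \<open>- b\<close> and variance \<open>1 / \<beta>\<close>, whose
  mass does not depend on \<open>b\<close>. This crude step is the passage from det(I + S) to
  det(S).\<close>

lemma std_normal_integral_shifted_gaussian:
  fixes A b c \<beta> :: real
  assumes c: "0 < c" and \<beta>: "c\<^sup>2 \<le> \<beta>"
  shows "integrable std_normal_distribution (\<lambda>x. exp (- (A + \<beta> * (x + b)\<^sup>2) / 2))"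
    and "(\<integral>x. exp (- (A + \<beta> * (x + b)\<^sup>2) / 2) \<partial>std_normal_distribution) \<le> exp (- A / 2) / c"
proof -
  interpret N: prob_space std_normal_distribution by (rule prob_space_std_normal)
  have "0 < c\<^sup>2" using c by simp
  then have b0: "0 < \<beta>" using \<beta> by linarith
  let ?f = "\<lambda>x. exp (- (A + \<beta> * (x + b)\<^sup>2) / 2)"
  let ?g = "\<lambda>x. exp (- A / 2) / sqrt \<beta> * normal_density (- b) (1 / sqrt \<beta>) x"
  show int: "integrable std_normal_distribution ?f"
  proof (rule N.integrable_const_bound[where B="exp (- A / 2)"])
    show "AE x in std_normal_distribution. norm (?f x) \<le> exp (- A / 2)"
      using b0 by (intro AE_I2) (simp add: field_simps)
  qed simp
  have fg: "std_normal_density x * ?f x \<le> ?g x" for x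
  proof -
    have "std_normal_density x \<le> 1 / sqrt (2 * pi)"
      unfolding std_normal_density_def
      by (rule mult_right_le_one_le) auto
    then have "std_normal_density x * ?f x \<le> 1 / sqrt (2 * pi) * ?f x"
      by (rule mult_right_mono) simp
    also have "\<dots> = ?g x"
    proof -
      have s: "(1 / sqrt \<beta>)\<^sup>2 = 1 / \<beta>" using b0 by (simp add: power_divide)
      have e: "?f x = exp (- A / 2) * exp (- (x - - b)\<^sup>2 / (2 * (1 / \<beta>)))"
        by (simp add: exp_add[symmetric] field_simps)
      have r: "sqrt (2 * pi * (1 / \<beta>)) = sqrt (2 * pi) / sqrt \<beta>"
        by (simp add: real_sqrt_divide)
      have n: "normal_density (- b) (1 / sqrt \<beta>) x
          = sqrt \<beta> / sqrt (2 * pi) * exp (- (x - - b)\<^sup>2 / (2 * (1 / \<beta>)))"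
        unfolding normal_density_def s r by simp
      show ?thesis unfolding n e using b0 by simp
    qed
    finally show ?thesis .
  qed
  have "(\<integral>x. ?f x \<partial>std_normal_distribution) = (\<integral>x. std_normal_density x * ?f x \<partial>lborel)"
    by (subst integral_density) auto
  also have "\<dots> \<le> (\<integral>x. ?g x \<partial>lborel)"
  proof (rule integral_mono[OF _ _ fg])
    show "integrable lborel (\<lambda>x. std_normal_density x * ?f x)"
      using int by (subst (asm) integrable_density) auto
    show "integrable lborel ?g" using b0 by (intro integrable_mult_right) simp
  qed
  also have "\<dots> = exp (- A / 2) / sqrt \<beta>"
    using b0 by simp
  also have "\<dots> \<le> exp (- A / 2) / c"
  proof -
    have "c \<le> sqrt \<beta>" using real_sqrt_le_mono[OF \<beta>] c by simp
    then show ?thesis using c b0 by (intro divide_left_mono) auto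
  qed
  finally show "(\<integral>x. ?f x \<partial>std_normal_distribution) \<le> exp (- A / 2) / c" .
qed

lemma std_normal_integral_iexp:
  "(\<integral>x. iexp (x * t) \<partial>std_normal_distribution) = complex_of_real (exp (- t\<^sup>2 / 2))"
  using fun_cong[OF char_std_normal_distribution, of t]
  by (simp add: char_def mult.commute)

text \<open>The index set is forgotten, so that scaled increments and the sums
  \<open>V + x * W n\<close> of the later induction stand on the same footing as the field itself.
  Gaussianity enters only through \<open>char_in\<close>.\<close>

locale centered_gaussian_space = prob_space M for M :: "'a measure" +
  fixes G :: "('a \<Rightarrow> real) set"
  assumes zero_in: "(\<lambda>_. 0) \<in> G"
    and lincomb_in: "f \<in> G \<Longrightarrow> g \<in> G \<Longrightarrow> (\<lambda>\<omega>. f \<omega> + a * g \<omega>) \<in> G"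
    and meas_in: "f \<in> G \<Longrightarrow> f \<in> borel_measurable M"
    and square_integrable_in: "f \<in> G \<Longrightarrow> integrable M (\<lambda>\<omega>. (f \<omega>)\<^sup>2)"
    and char_in: "f \<in> G \<Longrightarrow>
      (\<integral>\<omega>. iexp (f \<omega>) \<partial>M) = complex_of_real (exp (- (\<integral>\<omega>. (f \<omega>)\<^sup>2 \<partial>M) / 2))"
begin

lemma integrable_mult_in: "f \<in> G \<Longrightarrow> g \<in> G \<Longrightarrow> integrable M (\<lambda>\<omega>. f \<omega> * g \<omega>)"
  by (intro integrable_mult_of_squares meas_in square_integrable_in)

text \<open>The covariance of the residuals of \<open>U\<close> and \<open>V\<close> after projecting off \<open>W 0, \<dots>, W (n - 1)\<close>,
  written as an iterated Schur complement.\<close>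

fun residual_cov :: "(nat \<Rightarrow> 'a \<Rightarrow> real) \<Rightarrow> nat \<Rightarrow> ('a \<Rightarrow> real) \<Rightarrow> ('a \<Rightarrow> real) \<Rightarrow> real" where
  "residual_cov W 0 U V = (\<integral>\<omega>. U \<omega> * V \<omega> \<partial>M)"
| "residual_cov W (Suc n) U V = residual_cov W n U V
     - residual_cov W n U (W n) * residual_cov W n V (W n) / residual_cov W n (W n) (W n)"

lemma residual_cov_commute: "residual_cov W n U V = residual_cov W n V U"
proof (induction n arbitrary: U V)
  case 0 then show ?case by (simp add: mult.commute)
next
  case (Suc n)
  show ?case unfolding residual_cov.simps Suc[of U V] by (simp add: mult.commute)
qed

lemma residual_cov_lincomb:
  assumes "\<And>k. k < n \<Longrightarrow> W k \<in> G" "f \<in> G" "g \<in> G" "V \<in> G"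
  shows "residual_cov W n (\<lambda>\<omega>. f \<omega> + a * g \<omega>) V = residual_cov W n f V + a * residual_cov W n g V"
  using assms
proof (induction n arbitrary: V)
  case 0
  have "(\<integral>\<omega>. (f \<omega> + a * g \<omega>) * V \<omega> \<partial>M) = (\<integral>\<omega>. f \<omega> * V \<omega> + a * (g \<omega> * V \<omega>) \<partial>M)"
    by (simp add: algebra_simps)
  also have "\<dots> = (\<integral>\<omega>. f \<omega> * V \<omega> \<partial>M) + a * (\<integral>\<omega>. g \<omega> * V \<omega> \<partial>M)"
    using 0 integrable_mult_in by simp
  finally show ?case by simp
next
  case (Suc n)
  have W: "W n \<in> G" "\<And>k. k < n \<Longrightarrow> W k \<in> G" using Suc.prems by auto
  let ?h = "\<lambda>\<omega>. f \<omega> + a * g \<omega>"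
  have 1: "residual_cov W n ?h V = residual_cov W n f V + a * residual_cov W n g V"
    using Suc.prems W by (intro Suc.IH) auto
  have 2: "residual_cov W n ?h (W n) = residual_cov W n f (W n) + a * residual_cov W n g (W n)"
    using Suc.prems W by (intro Suc.IH) auto
  show ?case
    unfolding residual_cov.simps 1 2 by (simp add: algebra_simps add_divide_distrib)
qed

text \<open>Used in two directions: at its minimising \<open>a\<close> it yields the next level of
  elimination, and with the square completed it gives the Gaussian integrand of the Fourier
  induction.\<close>

lemma residual_cov_square:
  assumes W: "\<And>k. k < n \<Longrightarrow> W k \<in> G" and "f \<in> G" "g \<in> G"
  shows "residual_cov W n (\<lambda>\<omega>. f \<omega> + a * g \<omega>) (\<lambda>\<omega>. f \<omega> + a * g \<omega>)
    = residual_cov W n f f + 2 * a * residual_cov W n f g + a\<^sup>2 * residual_cov W n g g"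
proof -
  have h: "(\<lambda>\<omega>. f \<omega> + a * g \<omega>) \<in> G" using assms by (simp add: lincomb_in)
  let ?h = "\<lambda>\<omega>. f \<omega> + a * g \<omega>"
  have "residual_cov W n ?h ?h = residual_cov W n ?h f + a * residual_cov W n ?h g"
    by (simp only: residual_cov_lincomb[OF W assms(2,3) h] residual_cov_commute[of W n f ?h]
        residual_cov_commute[of W n g ?h])
  moreover have "residual_cov W n ?h f = residual_cov W n f f + a * residual_cov W n f g"
    using residual_cov_lincomb[OF W assms(2,3,2)] residual_cov_commute[of W n g f] by simp
  moreover have "residual_cov W n ?h g = residual_cov W n f g + a * residual_cov W n g g"
    by (rule residual_cov_lincomb[OF W assms(2,3,3)])
  ultimately show ?thesis
    by (simp only: algebra_simps power2_eq_square)
qed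

text \<open>One Gram-Schmidt step at a time: after subtracting the regression multiple
  \<open>l * W n\<close> from \<open>V\<close>, the level-\<open>n\<close> form of the difference
  equals the level-\<open>Suc n\<close> form of \<open>V\<close>, and the induction hypothesis
  applies to the difference. The coefficients need not be identified, since \<open>separated\<close>
  quantifies over all of them.\<close>

lemma residual_cov_residual:
  assumes "V \<in> G" "\<And>k. k < n \<Longrightarrow> W k \<in> G \<and> residual_cov W k (W k) (W k) \<noteq> 0"
  shows "\<exists>a. residual_cov W n V V = (\<integral>\<omega>. (V \<omega> - (\<Sum>k<n. a k * W k \<omega>))\<^sup>2 \<partial>M)"
  using assms
proof (induction n arbitrary: V)
  case 0 then show ?case by (simp add: power2_eq_square)
next
  case (Suc n)
  define l where "l = residual_cov W n V (W n) / residual_cov W n (W n) (W n)"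
  have W: "W n \<in> G" "\<And>k. k < n \<Longrightarrow> W k \<in> G" and nz: "residual_cov W n (W n) (W n) \<noteq> 0"
    using Suc.prems by auto
  let ?V = "\<lambda>\<omega>. V \<omega> + (- l) * W n \<omega>"
  have V: "?V \<in> G" using Suc.prems W by (intro lincomb_in) auto
  obtain a where a: "residual_cov W n ?V ?V = (\<integral>\<omega>. (?V \<omega> - (\<Sum>k<n. a k * W k \<omega>))\<^sup>2 \<partial>M)"
    using Suc.IH[OF V] Suc.prems(2) by auto
  have "residual_cov W (Suc n) V V
      = residual_cov W n V V + 2 * (- l) * residual_cov W n V (W n) + (- l)\<^sup>2 * residual_cov W n (W n) (W n)"
    using nz by (simp add: l_def field_simps power2_eq_square)
  also have "\<dots> = residual_cov W n ?V ?V"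
    by (rule residual_cov_square[OF W(2) Suc.prems(1) W(1), symmetric])
  also have "\<dots> = (\<integral>\<omega>. (V \<omega> - (\<Sum>k<Suc n. (a(n := l)) k * W k \<omega>))\<^sup>2 \<partial>M)"
  proof -
    have "(\<Sum>k<n. (a(n := l)) k * W k \<omega>) = (\<Sum>k<n. a k * W k \<omega>)" for \<omega>
      by (rule sum.cong) auto
    then show ?thesis unfolding a by (simp add: diff_diff_eq add.commute)
  qed
  finally show ?case by blast
qed

text \<open>Quantifying over all coefficients expresses the distance from the span of the
  predecessors without constructing a projection. Comparing with predecessors only is what makes the
  bounds multiply to one for the Gram determinant.\<close>

definition separated :: "real \<Rightarrow> nat \<Rightarrow> (nat \<Rightarrow> 'a \<Rightarrow> real) \<Rightarrow> bool" where
  "separated c n W \<longleftrightarrow> (\<forall>k<n. W k \<in> G \<and>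
     (\<forall>a. c\<^sup>2 \<le> (\<integral>\<omega>. (W k \<omega> - (\<Sum>j<k. a j * W j \<omega>))\<^sup>2 \<partial>M)))"

text \<open>Strong induction, because reading a residual variance as a squared distance divides by
  all earlier residual variances; that these do not vanish is the same claim at smaller
  indices.\<close>

lemma residual_cov_ge:
  assumes c: "0 < c" and W: "separated c n W" and "k < n"
  shows "c\<^sup>2 \<le> residual_cov W k (W k) (W k)"
  using \<open>k < n\<close>
proof (induction k rule: less_induct)
  case (less k)
  have "\<And>j. j < k \<Longrightarrow> W j \<in> G \<and> residual_cov W j (W j) (W j) \<noteq> 0"
  proof -
    fix j assume j: "j < k"
    have "c\<^sup>2 \<le> residual_cov W j (W j) (W j)" using less.IH[OF j] j less.prems by simp
    moreover have "0 < c\<^sup>2" using c by simp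
    ultimately show "W j \<in> G \<and> residual_cov W j (W j) (W j) \<noteq> 0"
      using W j less.prems by (auto simp: separated_def)
  qed
  moreover have "W k \<in> G" using W less.prems by (simp add: separated_def)
  ultimately obtain a where "residual_cov W k (W k) (W k) = (\<integral>\<omega>. (W k \<omega> - (\<Sum>j<k. a j * W j \<omega>))\<^sup>2 \<partial>M)"
    using residual_cov_residual[of "W k" k W] by blast
  then show ?case using W less.prems by (simp add: separated_def)
qed

text \<open>Writing \<open>exp (- (W n)\<^sup>2 / 2)\<close> as the Gaussian average of \<open>iexp (x * W n)\<close> over \<open>x\<close> replaces
  \<open>V\<close> by \<open>V + x * W n\<close>; completing the square in \<open>x\<close> turns the covariance form of level \<open>n\<close> into
  that of level \<open>Suc n\<close> and costs the factor \<open>1 / c\<close>.\<close>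

lemma fourier_bound:
  assumes c: "0 < c" and "separated c n W" and "V \<in> G"
  shows "norm (\<integral>\<omega>. iexp (V \<omega>) * complex_of_real (\<Prod>k<n. exp (- (W k \<omega>)\<^sup>2 / 2)) \<partial>M)
    \<le> (1 / c) ^ n * exp (- residual_cov W n V V / 2)"
  using assms(2,3)
proof (induction n arbitrary: V)
  case 0
  then show ?case by (simp add: char_in power2_eq_square)
next
  case (Suc n)
  let ?N = "std_normal_distribution"
  interpret N: prob_space ?N by (rule prob_space_std_normal)
  interpret P: pair_sigma_finite M ?N ..
  interpret PP: pair_prob_space M ?N ..
  have sep: "separated c n W" using Suc.prems by (simp add: separated_def)
  have W: "\<And>k. k < Suc n \<Longrightarrow> W k \<in> G" using Suc.prems by (simp add: separated_def)
  have Wn: "W n \<in> G" using W by simp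
  have [measurable]: "V \<in> borel_measurable M" "W n \<in> borel_measurable M"
    using Suc.prems W by (auto intro: meas_in)
  have Wm: "(\<lambda>\<omega>. \<Prod>k<n. exp (- (W k \<omega>)\<^sup>2 / 2)) \<in> borel_measurable M"
  proof (intro borel_measurable_prod)
    fix k assume "k \<in> {..<n}"
    then have [measurable]: "W k \<in> borel_measurable M" using W by (auto intro: meas_in)
    show "(\<lambda>\<omega>. exp (- (W k \<omega>)\<^sup>2 / 2)) \<in> borel_measurable M" by measurable
  qed
  define p where "p \<omega> = (\<Prod>k<n. exp (- (W k \<omega>)\<^sup>2 / 2))" for \<omega>
  have [measurable]: "p \<in> borel_measurable M" using Wm by (simp add: p_def[abs_def])
  let ?f = "\<lambda>\<omega> x. iexp (V \<omega> + x * W n \<omega>) * complex_of_real (p \<omega>)"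
  \<comment> \<open>In \<open>x\<close>, the level-\<open>n\<close> form of
    \<open>V + x * W n\<close> is a parabola with leading coefficient \<open>\<beta>\<close> and
    vertex \<open>- b\<close>; its minimum is the level-\<open>Suc n\<close> form of
    \<open>V\<close>.\<close>
  define \<beta> where "\<beta> = residual_cov W n (W n) (W n)"
  define b where "b = residual_cov W n V (W n) / \<beta>"
  have \<beta>: "c\<^sup>2 \<le> \<beta>" unfolding \<beta>_def by (rule residual_cov_ge[OF c Suc.prems(1)]) simp
  moreover have "0 < c\<^sup>2" using c by simp
  ultimately have b0: "\<beta> > 0" by linarith
  have p1: "norm (p \<omega>) \<le> 1" for \<omega>
    unfolding p_def by (auto simp: abs_prod intro!: prod_le_1)
  have intf: "integrable (M \<Otimes>\<^sub>M ?N) (case_prod ?f)"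
  proof (rule PP.integrable_const_bound[where B=1])
    show "AE z in M \<Otimes>\<^sub>M ?N. norm (case_prod ?f z) \<le> 1"
      using p1 by (intro AE_I2) (auto simp: norm_mult)
  qed measurable
  have "(\<integral>\<omega>. iexp (V \<omega>) * complex_of_real (\<Prod>k<Suc n. exp (- (W k \<omega>)\<^sup>2 / 2)) \<partial>M)
     = (\<integral>\<omega>. (\<integral>x. ?f \<omega> x \<partial>?N) \<partial>M)"
  proof (rule Bochner_Integration.integral_cong[OF refl])
    fix \<omega>
    have "(\<integral>x. ?f \<omega> x \<partial>?N) = (\<integral>x. (iexp (V \<omega>) * complex_of_real (p \<omega>)) * iexp (x * W n \<omega>) \<partial>?N)"
      by (rule Bochner_Integration.integral_cong[OF refl]) (simp add: exp_add distrib_left mult_ac)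
    also have "\<dots> = (iexp (V \<omega>) * complex_of_real (p \<omega>)) * (\<integral>x. iexp (x * W n \<omega>) \<partial>?N)"
      by (rule integral_mult_right_zero)
    finally show "iexp (V \<omega>) * complex_of_real (\<Prod>k<Suc n. exp (- (W k \<omega>)\<^sup>2 / 2)) = (\<integral>x. ?f \<omega> x \<partial>?N)"
      unfolding std_normal_integral_iexp by (simp only: prod.lessThan_Suc p_def of_real_mult mult_ac)
  qed
  also have "\<dots> = (\<integral>x. (\<integral>\<omega>. ?f \<omega> x \<partial>M) \<partial>?N)"
    by (rule P.Fubini_integral[symmetric]) (rule intf)
  also have "norm \<dots> \<le> (\<integral>x. norm (\<integral>\<omega>. ?f \<omega> x \<partial>M) \<partial>?N)"
    by (rule integral_norm_bound)
  also have "\<dots> \<le> (\<integral>x. (1 / c) ^ n * exp (- (residual_cov W (Suc n) V V + \<beta> * (x + b)\<^sup>2) / 2) \<partial>?N)"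
  proof (rule integral_mono)
    show "integrable ?N (\<lambda>x. norm (\<integral>\<omega>. ?f \<omega> x \<partial>M))"
      by (rule integrable_norm) (rule P.integrable_snd[OF intf])
    show "integrable ?N (\<lambda>x. (1 / c) ^ n * exp (- (residual_cov W (Suc n) V V + \<beta> * (x + b)\<^sup>2) / 2))"
      by (rule integrable_mult_right) (rule std_normal_integral_shifted_gaussian[OF c \<beta>])
    fix x
    let ?V = "\<lambda>\<omega>. V \<omega> + x * W n \<omega>"
    have V: "?V \<in> G" using Suc.prems Wn by (simp add: lincomb_in)
    have "residual_cov W n ?V ?V = residual_cov W (Suc n) V V + \<beta> * (x + b)\<^sup>2"
    proof -
      have "residual_cov W n ?V ?V = residual_cov W n V V + 2 * x * residual_cov W n V (W n) + x\<^sup>2 * \<beta>"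
        unfolding \<beta>_def by (rule residual_cov_square) (use W Suc.prems in auto)
      also have "\<dots> = residual_cov W (Suc n) V V + \<beta> * (x + b)\<^sup>2"
        unfolding residual_cov.simps \<beta>_def[symmetric] b_def
        using b0 by (simp add: field_simps power2_eq_square)
      finally show ?thesis .
    qed
    then show "norm (\<integral>\<omega>. ?f \<omega> x \<partial>M) \<le>
        (1 / c) ^ n * exp (- (residual_cov W (Suc n) V V + \<beta> * (x + b)\<^sup>2) / 2)"
      using Suc.IH[OF sep V] by (simp only: p_def)
  qed
  also have "\<dots> = (1 / c) ^ n * (\<integral>x. exp (- (residual_cov W (Suc n) V V + \<beta> * (x + b)\<^sup>2) / 2) \<partial>?N)"
    by (rule integral_mult_right_zero)
  also have "\<dots> \<le> (1 / c) ^ n * (exp (- residual_cov W (Suc n) V V / 2) / c)"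
    using c by (intro mult_left_mono std_normal_integral_shifted_gaussian(2)[OF c \<beta>]) simp
  finally show ?case by (simp only: power_Suc mult_ac times_divide_eq_right times_divide_eq_left mult_1_left mult_1_right)
qed

text \<open>A Chernoff-type bound: on the event each factor
  \<open>exp (1/2) * exp (- (W k \<omega>)\<^sup>2 / 2)\<close> is at least 1, so the product
  dominates the indicator, and its expectation is the Fourier integral at
  \<open>V = 0\<close>.\<close>

lemma small_ball_separated:
  assumes c: "0 < c" and sep: "separated c n W"
  shows "measure M {\<omega>\<in>space M. \<forall>k<n. \<bar>W k \<omega>\<bar> \<le> 1} \<le> (exp (1/2) / c) ^ n"
proof -
  have W: "\<And>k. k < n \<Longrightarrow> W k \<in> G" using sep by (simp add: separated_def)
  have Wm: "\<And>k. k < n \<Longrightarrow> W k \<in> borel_measurable M" using W by (auto intro: meas_in)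
  let ?E = "{\<omega>\<in>space M. \<forall>k<n. \<bar>W k \<omega>\<bar> \<le> 1}"
  have E[measurable]: "?E \<in> sets M"
  proof -
    have "?E = {\<omega>\<in>space M. \<forall>k\<in>{..<n}. \<bar>W k \<omega>\<bar> \<le> 1}" by auto
    also have "\<dots> \<in> sets M"
      by (rule sets.sets_Collect_finite_All) (use Wm in \<open>auto intro!: borel_measurable_le\<close>)
    finally show ?thesis .
  qed
  let ?p = "\<lambda>\<omega>. \<Prod>k<n. exp (- (W k \<omega>)\<^sup>2 / 2)"
  have pm[measurable]: "?p \<in> borel_measurable M"
  proof (intro borel_measurable_prod)
    fix k assume "k \<in> {..<n}"
    then have [measurable]: "W k \<in> borel_measurable M" using Wm by auto
    show "(\<lambda>\<omega>. exp (- (W k \<omega>)\<^sup>2 / 2)) \<in> borel_measurable M" by measurable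
  qed
  have p0: "0 \<le> ?p \<omega>" "?p \<omega> \<le> 1" for \<omega>
    by (auto intro!: prod_nonneg prod_le_1)
  have ip: "integrable M ?p"
    by (rule integrable_const_bound[where B=1, OF AE_I2 pm]) (use p0 in simp)
  have "measure M ?E = (\<integral>\<omega>. indicator ?E \<omega> \<partial>M)"
    by (subst Bochner_Integration.integral_indicator) (rule arg_cong[where f="measure M"], blast)
  also have "\<dots> \<le> (\<integral>\<omega>. exp (1/2) ^ n * ?p \<omega> \<partial>M)"
  proof (rule integral_mono)
    show "integrable M (indicator ?E :: 'a \<Rightarrow> real)"
      using E by (rule integrable_real_indicator) (simp add: emeasure_eq_measure)
    show "integrable M (\<lambda>\<omega>. exp (1/2) ^ n * ?p \<omega>)"
      using ip by (rule integrable_mult_right)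
    fix \<omega>
    show "indicator ?E \<omega> \<le> exp (1/2) ^ n * ?p \<omega>"
    proof (cases "\<omega> \<in> ?E")
      case True
      have "exp (1/2) ^ n * ?p \<omega> = (\<Prod>k<n. exp (1/2) * exp (- (W k \<omega>)\<^sup>2 / 2))"
        by (simp add: prod.distrib)
      moreover have "1 \<le> \<dots>"
      proof (rule prod_ge_1)
        fix k assume "k \<in> {..<n}"
        then have "\<bar>W k \<omega>\<bar> \<le> 1" using True by auto
        then have "(W k \<omega>)\<^sup>2 \<le> 1" by (simp add: abs_square_le_1)
        then show "1 \<le> exp (1/2) * exp (- (W k \<omega>)\<^sup>2 / 2)" by (simp add: exp_add[symmetric])
      qed
      ultimately show ?thesis using True by simp
    qed (use p0 in simp)
  qed
  also have "\<dots> = exp (1/2) ^ n * (\<integral>\<omega>. ?p \<omega> \<partial>M)"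
    by (rule integral_mult_right_zero)
  also have "(\<integral>\<omega>. ?p \<omega> \<partial>M) \<le> norm (\<integral>\<omega>. iexp 0 * complex_of_real (?p \<omega>) \<partial>M)"
    by (simp del: of_real_prod)
  also have "\<dots> \<le> (1 / c) ^ n * exp (- residual_cov W n (\<lambda>_. 0) (\<lambda>_. 0) / 2)"
    using fourier_bound[OF c sep zero_in] by simp
  \<comment> \<open>Taking both functions zero and \<open>a = -1\<close> in the quadratic formula
    gives x = x - 2 x + x for this value x.\<close>
  also have "residual_cov W n (\<lambda>_. 0) (\<lambda>_. 0) = 0"
    using residual_cov_square[of n W "\<lambda>_. 0" "\<lambda>_. 0" "-1"] W zero_in by simp
  finally show ?thesis by (simp add: power_divide mult_left_mono)
qed

end

section \<open>Small balls of Gaussian fields\<close>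

definition linear_combinations :: "('t \<Rightarrow> 'a \<Rightarrow> real) \<Rightarrow> ('a \<Rightarrow> real) set" where
  "linear_combinations Y = {\<lambda>\<omega>. \<Sum>t\<in>S. c t * Y t \<omega> | S c. finite S}"

lemma linear_combinationsI:
  assumes "finite S" "\<And>\<omega>. f \<omega> = (\<Sum>t\<in>S. c t * Y t \<omega>)"
  shows "f \<in> linear_combinations Y"
  unfolding linear_combinations_def mem_Collect_eq
  by (rule exI[of _ S], rule exI[of _ c]) (use assms in auto)

lemma linear_combinationsE:
  assumes "f \<in> linear_combinations Y"
  obtains S c where "finite S" "f = (\<lambda>\<omega>. \<Sum>t\<in>S. c t * Y t \<omega>)"
  using assms unfolding linear_combinations_def mem_Collect_eq
  by (elim exE conjE) (rule that)

lemma in_linear_combinations: "Y t \<in> linear_combinations Y"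
  by (rule linear_combinationsI[of "{t}" _ "\<lambda>_. 1"]) auto

lemma centered_gaussian_space_field:
  fixes Y :: "'t \<Rightarrow> 'a \<Rightarrow> real"
  assumes g: "gaussian_field M Y" and mean: "\<And>t. (\<integral>\<omega>. Y t \<omega> \<partial>M) = 0"
  shows "centered_gaussian_space M (linear_combinations Y)"
    (is "centered_gaussian_space M ?G")
proof -
  have M: "prob_space M" using g by (simp add: gaussian_field_def)
  have grv: "gaussian_rv M f" if "f \<in> ?G" for f
  proof -
    from that obtain S c where S: "finite S" "f = (\<lambda>\<omega>. \<Sum>t\<in>S. c t * Y t \<omega>)"
      by (rule linear_combinationsE)
    have "gaussian_rv M (\<lambda>\<omega>. \<Sum>t\<in>S. c t \<bullet> Y t \<omega>)"
      by (rule g[unfolded gaussian_field_def, THEN conjunct2, THEN conjunct2, rule_format, OF S(1)])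
    then show ?thesis unfolding S(2) inner_real_def .
  qed
  note Y = in_linear_combinations[of Y]
  have int: "integrable M (Y t)" for t
    using gaussian_rv_integrable(1)[OF M grv[OF Y]] .
  have mean0: "(\<integral>\<omega>. f \<omega> \<partial>M) = 0" if "f \<in> ?G" for f
    using that by (rule linear_combinationsE) (simp add: int mean)
  interpret prob_space M by fact
  show ?thesis
  proof
    show "(\<lambda>_. 0) \<in> ?G" by (rule linear_combinationsI[of "{}"]) auto
    show "f \<in> borel_measurable M" if "f \<in> ?G" for f
      using grv[OF that] by (simp add: gaussian_rv_def)
    show "integrable M (\<lambda>\<omega>. (f \<omega>)\<^sup>2)" if "f \<in> ?G" for f
      using gaussian_rv_integrable(2)[OF M grv[OF that]] .
    show "(\<integral>\<omega>. iexp (f \<omega>) \<partial>M) = complex_of_real (exp (- (\<integral>\<omega>. (f \<omega>)\<^sup>2 \<partial>M) / 2))"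
      if "f \<in> ?G" for f
      using centered_gaussian_char[OF M grv[OF that] mean0[OF that]] .
    show "(\<lambda>\<omega>. f \<omega> + a * h \<omega>) \<in> ?G" if "f \<in> ?G" "h \<in> ?G" for f h a
    proof -
      from that(1) obtain S c where S: "finite S" "f = (\<lambda>\<omega>. \<Sum>t\<in>S. c t * Y t \<omega>)"
        by (rule linear_combinationsE)
      from that(2) obtain S' c' where S': "finite S'" "h = (\<lambda>\<omega>. \<Sum>t\<in>S'. c' t * Y t \<omega>)"
        by (rule linear_combinationsE)
      \<comment> \<open>Both coefficient families are extended by 0 to the union of the index
        sets.\<close>
      let ?d = "\<lambda>t. (if t \<in> S then c t else 0) + a * (if t \<in> S' then c' t else 0)"
      have "f \<omega> + a * h \<omega> = (\<Sum>t\<in>S \<union> S'. ?d t * Y t \<omega>)" for \<omega>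
      proof -
        have "(\<Sum>t\<in>S \<union> S'. ?d t * Y t \<omega>) = (\<Sum>t\<in>S \<union> S'. if t \<in> S then c t * Y t \<omega> else 0)
            + a * (\<Sum>t\<in>S \<union> S'. if t \<in> S' then c' t * Y t \<omega> else 0)"
          unfolding sum_distrib_left sum.distrib[symmetric]
          by (rule sum.cong) (auto simp: algebra_simps)
        also have "\<dots> = f \<omega> + a * h \<omega>"
          using S S' by (simp add: sum.inter_restrict[symmetric] Int_absorb1 Int_absorb2)
        finally show ?thesis by simp
      qed
      then show ?thesis using S(1) S'(1) by (intro linear_combinationsI[of "S \<union> S'" _ ?d]) auto
    qed
  qed
qed

lemma subalgebra_generated_algebra:
  assumes "\<And>k. k \<in> {1..n} \<Longrightarrow> Z k \<in> borel_measurable M"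
  shows "subalgebra M (generated_algebra M n Z)"
proof -
  have m: "(\<lambda>\<omega>. \<lambda>k\<in>{1..n}. Z k \<omega>) \<in> measurable M (\<Pi>\<^sub>M k\<in>{1..n}. borel)"
    using assms by (intro measurable_restrict) auto
  show ?thesis
    unfolding subalgebra_def generated_algebra_def
    using m by (auto simp: measurable_iff_sets)
qed

lemma measurable_generated_algebra:
  assumes "k \<in> {1..n}"
  shows "Z k \<in> borel_measurable (generated_algebra M n Z)"
proof -
  have "(\<lambda>\<omega>. \<lambda>k\<in>{1..n}. Z k \<omega>) \<in> measurable (generated_algebra M n Z) (\<Pi>\<^sub>M k\<in>{1..n}. borel)"
    unfolding generated_algebra_def
    by (rule measurable_vimage_algebra1) (auto simp: space_PiM)
  from measurable_compose[OF this measurable_component_singleton[OF assms]]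
  show ?thesis using assms by simp
qed

text \<open>(A2) is applied to \<open>Y (s k)\<close> given \<open>Y t\<close> and the earlier
  \<open>Y (s j)\<close>. Combinations of earlier increments, shifted by \<open>Y t\<close>, are
  measurable for these, so the increment at \<open>s k\<close> stays at L^2 distance at least
  \<open>sqrt C3 * \<delta>\<close> from the span of the earlier ones. Dividing by
  \<open>exp (3 / 2)\<close> in the threshold makes the scaled increments separated with constant
  \<open>exp (3 / 2)\<close>, and then \<open>exp (1 / 2) / exp (3 / 2)\<close> is e^(-1).\<close>

lemma small_ball_field:
  fixes Y :: "real ^ 'n \<Rightarrow> 'a \<Rightarrow> real" and s :: "nat \<Rightarrow> real ^ 'n"
  assumes g: "gaussian_field M Y" and mean: "\<And>t. (\<integral>\<omega>. Y t \<omega> \<partial>M) = 0"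
    and C3: "0 < C3"
    and A2: "\<And>n t \<tau>. 1 \<le> n \<Longrightarrow> t \<in> T \<Longrightarrow> \<tau> 0 = 0 \<Longrightarrow> (\<forall>k\<in>{1..n}. \<tau> k \<in> T) \<Longrightarrow>
        AE \<omega> in M. cond_variance M (generated_algebra M n (\<lambda>k. Y (\<tau> k))) (Y t) \<omega>
             \<ge> C3 * (MIN k\<in>{0..n::nat}. (rho H t (\<tau> k))\<^sup>2)"
    and \<delta>: "0 < \<delta>" and t: "t \<in> T" and sT: "\<And>k. k < n \<Longrightarrow> s k \<in> T"
    and st: "\<And>k. k < n \<Longrightarrow> \<delta> \<le> rho H (s k) t" and s0: "\<And>k. k < n \<Longrightarrow> \<delta> \<le> rho H (s k) 0"
    and ss: "\<And>j k. j < k \<Longrightarrow> k < n \<Longrightarrow> \<delta> \<le> rho H (s k) (s j)"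
  shows "measure M {\<omega>\<in>space M. \<forall>k<n. \<bar>Y (s k) \<omega> - Y t \<omega>\<bar> \<le> sqrt C3 * \<delta> / exp (3 / 2)} \<le> exp (- real n)"
proof -
  let ?G = "linear_combinations Y"
  interpret centered_gaussian_space M ?G by (rule centered_gaussian_space_field[OF g mean])
  define \<epsilon> where "\<epsilon> = sqrt C3 * \<delta> / exp (3 / 2)"
  have e0: "0 < \<epsilon>" using C3 \<delta> by (simp add: \<epsilon>_def)
  note Y = in_linear_combinations[of Y]
  have Ym[measurable]: "Y t \<in> borel_measurable M" for t by (rule meas_in[OF Y])
  have scale: "(\<lambda>\<omega>. a * f \<omega>) \<in> ?G" if "f \<in> ?G" for f a
    using lincomb_in[OF zero_in that, of a] by simp
  have add: "(\<lambda>\<omega>. f \<omega> + h \<omega>) \<in> ?G" if "f \<in> ?G" "h \<in> ?G" for f h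
    using lincomb_in[OF that, of 1] by simp
  have sumG: "(\<lambda>\<omega>. \<Sum>j<(k::nat). f j \<omega>) \<in> ?G" if "\<And>j. f j \<in> ?G" for f k
    by (induction k) (use zero_in add that in \<open>auto simp del: mem_Collect_eq\<close>)
  define W where "W k = (\<lambda>\<omega>. (1 / \<epsilon>) * (Y (s k) \<omega> + (-1) * Y t \<omega>))" for k
  have W: "W k \<in> ?G" for k
    unfolding W_def by (rule scale, rule lincomb_in[OF Y Y])
  have "separated (exp (3 / 2)) n W"
    unfolding separated_def
  proof (intro allI impI conjI W)
    fix k a assume k: "k < n"
    define L where "L = (\<lambda>\<omega>. Y t \<omega> + (\<Sum>j<k. a j * (Y (s j) \<omega> - Y t \<omega>)))"
    \<comment> \<open>Slot 0 is the origin prescribed by (A2) and slot 1 is \<open>t\<close>. So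
      there are \<open>k + 1\<close> conditioning points, at least one even for
      \<open>k = 0\<close>, and the earlier points start at slot 2.\<close>
    define \<tau> where "\<tau> = (\<lambda>i::nat. if i = 0 then 0 else if i = 1 then t else s (i - 2))"
    let ?F = "generated_algebra M (k + 1) (\<lambda>i. Y (\<tau> i))"
    have \<tau>T: "\<forall>i\<in>{1..k + 1}. \<tau> i \<in> T" using t sT k by (auto simp: \<tau>_def)
    have d: "\<delta>\<^sup>2 \<le> (rho H (s k) (\<tau> i))\<^sup>2" if "i \<in> {0..k + 1}" for i
    proof (rule power_mono)
      consider "i = 0" | "i = 1" | "2 \<le> i" by linarith
      then show "\<delta> \<le> rho H (s k) (\<tau> i)"
      proof cases
        case 3
        then have "i - 2 < k" using that by auto
        then show ?thesis using ss[OF _ k, of "i - 2"] 3 by (simp add: \<tau>_def)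
      qed (use st s0 k in \<open>auto simp: \<tau>_def\<close>)
    qed (use \<delta> in simp)
    then have min: "\<delta>\<^sup>2 \<le> (MIN i\<in>{0..k + 1}. (rho H (s k) (\<tau> i))\<^sup>2)"
      by (subst Min_ge_iff) auto
    have cv: "AE \<omega> in M. C3 * \<delta>\<^sup>2 \<le> cond_variance M ?F (Y (s k)) \<omega>"
      using A2[of "k + 1" "s k" \<tau>, OF _ sT[OF k] _ \<tau>T]
    proof (rule AE_mp)
      show "AE \<omega> in M. C3 * (MIN i\<in>{0..k + 1}. (rho H (s k) (\<tau> i))\<^sup>2) \<le> cond_variance M ?F (Y (s k)) \<omega>
        \<longrightarrow> C3 * \<delta>\<^sup>2 \<le> cond_variance M ?F (Y (s k)) \<omega>"
        using mult_left_mono[OF min, of C3] C3 by (intro AE_I2) linarith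
    qed (auto simp: \<tau>_def)
    have Ft: "Y t \<in> borel_measurable ?F"
      using measurable_generated_algebra[of 1 "k + 1" "\<lambda>i. Y (\<tau> i)" M] by (simp add: \<tau>_def)
    have Fs: "Y (s j) \<in> borel_measurable ?F" if "j < k" for j
      using measurable_generated_algebra[of "j + 2" "k + 1" "\<lambda>i. Y (\<tau> i)" M] that by (simp add: \<tau>_def)
    have LF: "L \<in> borel_measurable ?F"
      unfolding L_def using Ft Fs
      by (intro borel_measurable_add borel_measurable_sum borel_measurable_times borel_measurable_diff) auto
    have LG: "L \<in> ?G"
      unfolding L_def
    proof (intro add sumG Y scale)
      fix j show "(\<lambda>\<omega>. Y (s j) \<omega> - Y t \<omega>) \<in> ?G" using lincomb_in[OF Y Y, of "s j" "-1" t] by simp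
    qed
    have sub: "subalgebra M ?F" by (rule subalgebra_generated_algebra) simp
    have ge: "C3 * \<delta>\<^sup>2 \<le> (\<integral>\<omega>. (Y (s k) \<omega> - L \<omega>)\<^sup>2 \<partial>M)"
      by (rule integral_square_ge_cond_variance[OF sub Ym square_integrable_in[OF Y] LF square_integrable_in[OF LG] cv])
    have eq: "W k \<omega> - (\<Sum>j<k. a j * W j \<omega>) = (1 / \<epsilon>) * (Y (s k) \<omega> - L \<omega>)" for \<omega>
    proof -
      have "(\<Sum>j<k. a j * W j \<omega>) = (1 / \<epsilon>) * (\<Sum>j<k. a j * (Y (s j) \<omega> - Y t \<omega>))"
        unfolding sum_distrib_left by (rule sum.cong) (auto simp: W_def)
      then show ?thesis by (simp only: W_def L_def) (simp add: algebra_simps)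
    qed
    have "(exp (3 / 2))\<^sup>2 = (1 / \<epsilon>)\<^sup>2 * (C3 * \<delta>\<^sup>2)"
      using C3 \<delta> by (simp add: \<epsilon>_def power_divide power_mult_distrib)
    also have "\<dots> \<le> (1 / \<epsilon>)\<^sup>2 * (\<integral>\<omega>. (Y (s k) \<omega> - L \<omega>)\<^sup>2 \<partial>M)"
      by (rule mult_left_mono[OF ge]) simp
    also have "\<dots> = (\<integral>\<omega>. (W k \<omega> - (\<Sum>j<k. a j * W j \<omega>))\<^sup>2 \<partial>M)"
      unfolding eq power_mult_distrib by simp
    finally show "(exp (3 / 2))\<^sup>2 \<le> (\<integral>\<omega>. (W k \<omega> - (\<Sum>j<k. a j * W j \<omega>))\<^sup>2 \<partial>M)" .
  qed
  then have "measure M {\<omega>\<in>space M. \<forall>k<n. \<bar>W k \<omega>\<bar> \<le> 1} \<le> (exp (1 / 2) / exp (3 / 2)) ^ n"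
    by (intro small_ball_separated) auto
  also have "exp (1 / 2) / exp (3 / 2 :: real) = exp (- 1)"
    by (simp add: exp_diff[symmetric])
  also have "exp (- 1 :: real) ^ n = exp (- real n)" by (simp add: exp_of_nat_mult[symmetric])
  also have "{\<omega>\<in>space M. \<forall>k<n. \<bar>W k \<omega>\<bar> \<le> 1} = {\<omega>\<in>space M. \<forall>k<n. \<bar>Y (s k) \<omega> - Y t \<omega>\<bar> \<le> \<epsilon>}"
    using e0 by (auto simp: W_def abs_mult field_simps)
  finally show ?thesis by (simp add: \<epsilon>_def)
qed

section \<open>Geometry of the anisotropic metric\<close>

text \<open>By homogeneity the sum may be normalised to 1, where each summand satisfies
  \<open>u \<le> u powr h\<close>. This is the triangle inequality for \<open>rho\<close> in one
  coordinate.\<close>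

lemma powr_add_le_add_powr:
  fixes x y h :: real
  assumes x: "0 \<le> x" and y: "0 \<le> y" and h: "0 < h" "h \<le> 1"
  shows "(x + y) powr h \<le> x powr h + y powr h"
proof (cases "x + y = 0")
  case True then show ?thesis using x y h by simp
next
  case False
  then have s: "0 < x + y" using x y by simp
  have *: "u \<le> u powr h" if "0 \<le> u" "u \<le> 1" for u :: real
  proof (cases "u = 0")
    case False
    then have "u powr 1 \<le> u powr h" using that h by (intro powr_mono') auto
    then show ?thesis using False that by simp
  qed (use h in simp)
  have "1 = x / (x + y) + y / (x + y)" using s by (simp add: add_divide_distrib[symmetric])
  also have "\<dots> \<le> (x / (x + y)) powr h + (y / (x + y)) powr h"
    using x y s by (intro add_mono *) auto
  also have "\<dots> = (x powr h + y powr h) / (x + y) powr h"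
    using x y s by (simp add: powr_divide add_divide_distrib)
  finally show ?thesis using s by (simp add: field_simps)
qed

lemma rho_commute: "rho H s t = rho H t s"
  by (simp add: rho_def abs_minus_commute)

lemma rho_self: "rho H t t = 0"
  by (simp add: rho_def)

lemma rho_triangle:
  assumes "\<And>j. 0 < H $ j \<and> H $ j < 1"
  shows "rho H s u \<le> rho H s t + rho H t u"
  unfolding rho_def sum.distrib[symmetric]
proof (rule sum_mono)
  fix j
  have "\<bar>s $ j - u $ j\<bar> powr (H $ j) \<le> (\<bar>s $ j - t $ j\<bar> + \<bar>t $ j - u $ j\<bar>) powr (H $ j)"
    using assms[of j] by (intro powr_mono2) auto
  also have "\<dots> \<le> \<bar>s $ j - t $ j\<bar> powr (H $ j) + \<bar>t $ j - u $ j\<bar> powr (H $ j)"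
    using assms[of j] by (intro powr_add_le_add_powr) auto
  finally show "\<bar>s $ j - u $ j\<bar> powr (H $ j) \<le> \<bar>s $ j - t $ j\<bar> powr (H $ j) + \<bar>t $ j - u $ j\<bar> powr (H $ j)" .
qed

text \<open>Starting at \<open>t\<close>, coordinate \<open>j\<close> moves in steps of length
  \<open>u j\<close>, each worth \<open>r / (CARD('n) * p)\<close> in \<open>rho\<close>; up to
  \<open>p powr (1 / H $ j)\<close> of them together are worth at most \<open>r / CARD('n)\<close>.
  Multiplying the numbers of choices produces the exponent Q, and distinct grid points differ by at
  least a full step in some coordinate.\<close>

lemma separated_grid:
  fixes H t a b :: "real ^ 'n" and p :: real
  assumes H: "\<And>j. 0 < H $ j \<and> H $ j < 1" and T: "T = cbox a b \<or> T = box a b" and t: "t \<in> T"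
    and r: "0 < r" and small: "\<And>j. (r / CARD('n)) powr (1 / H $ j) < (b $ j - a $ j) / 2"
    and p: "1 \<le> p"
  obtains S where "finite S" "S \<subseteq> T" "S \<subseteq> B_rho H t r"
    "p powr (\<Sum>j\<in>UNIV. 1 / H $ j) \<le> card S"
    "\<And>s s'. s \<in> S \<Longrightarrow> s' \<in> S \<Longrightarrow> s \<noteq> s' \<Longrightarrow> r / (CARD('n) * p) \<le> rho H s s'"
proof -
  let ?N = "real CARD('n)"
  define L where "L j = nat \<lfloor>p powr (1 / H $ j)\<rfloor>" for j
  define u where "u j = (r / (?N * p)) powr (1 / H $ j)" for j
  \<comment> \<open>Each coordinate moves towards the farther face, where at least half of the edge
    is available; by \<open>small\<close> the total displacement is strictly less, so the point also
    stays inside an open box.\<close>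
  define \<sigma> :: "'n \<Rightarrow> real" where "\<sigma> j = (if t $ j \<le> (a $ j + b $ j) / 2 then 1 else -1)" for j
  define v where "v k = (\<chi> j. t $ j + \<sigma> j * (real (k j) * u j))" for k
  \<comment> \<open>Both ends of \<open>{0..L j}\<close> count: the floor plus one is at least
    \<open>p powr (1 / H $ j)\<close>.\<close>
  define K where "K = PiE UNIV (\<lambda>j. {0..L j})"
  have N: "0 < ?N" by simp
  have rN: "0 < r / (?N * p)" using r p by simp
  have u0: "0 < u j" for j using r p by (simp add: u_def)
  have s1: "\<bar>\<sigma> j\<bar> = 1" for j by (simp add: \<sigma>_def)
  have uH: "u j powr (H $ j) = r / (?N * p)" for j
  proof -
    have "u j powr (H $ j) = (r / (?N * p)) powr 1"
      unfolding u_def powr_powr using H[of j] by simp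
    then show ?thesis using r p by simp
  qed
  have ku: "real (k j) * u j \<le> (r / ?N) powr (1 / H $ j)" if "k \<in> K" for k j
  proof -
    have "k j \<le> L j" using that by (auto simp: K_def)
    then have "real (k j) \<le> p powr (1 / H $ j)"
      unfolding L_def by (rule order_trans[OF of_nat_mono of_nat_floor]) simp
    then have "real (k j) * u j \<le> p powr (1 / H $ j) * u j"
      using u0[of j] by (intro mult_right_mono) auto
    also have "\<dots> = (p * (r / (?N * p))) powr (1 / H $ j)"
      unfolding u_def by (rule powr_mult[symmetric])
    also have "p * (r / (?N * p)) = r / ?N" using p by simp
    finally show ?thesis .
  qed
  have diff: "\<bar>v k $ j - v k' $ j\<bar> = \<bar>real (k j) - real (k' j)\<bar> * u j" for k k' j
  proof -
    have "v k $ j - v k' $ j = \<sigma> j * ((real (k j) - real (k' j)) * u j)"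
      by (simp add: v_def algebra_simps)
    then show ?thesis using s1[of j] u0[of j] by (simp add: abs_mult)
  qed
  have sep: "r / (?N * p) \<le> rho H (v k) (v k')" if k: "k \<in> K" "k' \<in> K" "k \<noteq> k'" for k k'
  proof -
    obtain j where j: "k j \<noteq> k' j" using k(3) by (auto simp only: fun_eq_iff)
    have "1 \<le> \<bar>real (k j) - real (k' j)\<bar>" using j by linarith
    then have "u j \<le> \<bar>v k $ j - v k' $ j\<bar>"
      unfolding diff using u0[of j] by simp
    then have "u j powr (H $ j) \<le> \<bar>v k $ j - v k' $ j\<bar> powr (H $ j)"
      using u0[of j] H[of j] by (intro powr_mono2) auto
    also have "\<dots> \<le> rho H (v k) (v k')"
      unfolding rho_def by (rule member_le_sum) auto
    finally show ?thesis by (simp add: uH)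
  qed
  have inj: "inj_on v K"
  proof (rule inj_onI, rule ccontr)
    fix k k' assume k: "k \<in> K" "k' \<in> K" "v k = v k'" "k \<noteq> k'"
    show False using sep[OF k(1,2,4)] k(3) rN by (simp add: rho_self)
  qed
  have fin: "finite K" unfolding K_def by (intro finite_PiE) auto
  show thesis
  proof (rule that[of "v ` K"])
    show "finite (v ` K)" using fin by simp
    show "v ` K \<subseteq> T"
    proof
      fix x assume "x \<in> v ` K"
      then obtain k where k: "k \<in> K" "x = v k" by blast
      have ab: "a $ j \<le> t $ j \<and> t $ j \<le> b $ j" for j
        using T t by (auto simp: mem_box_cart less_imp_le)
      have "0 \<le> real (k j) * u j \<and> real (k j) * u j < (b $ j - a $ j) / 2" for j
        using ku[OF k(1), of j] small[of j] u0[of j] by simp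
      then have *: "\<exists>y. 0 \<le> y \<and> y < (b $ j - a $ j) / 2 \<and> x $ j = t $ j + \<sigma> j * y" for j
        unfolding k(2) v_def by auto
      have "a $ j \<le> x $ j \<and> x $ j \<le> b $ j \<and> (a $ j < t $ j \<and> t $ j < b $ j \<longrightarrow> a $ j < x $ j \<and> x $ j < b $ j)" for j
        using *[of j] ab[of j] by (auto simp: \<sigma>_def field_simps split: if_splits)
      then show "x \<in> T" using T t by (auto simp: mem_box_cart)
    qed
    show "v ` K \<subseteq> B_rho H t r"
    proof
      fix x assume "x \<in> v ` K"
      then obtain k where k: "k \<in> K" "x = v k" by blast
      have "\<bar>x $ j - t $ j\<bar> powr (H $ j) \<le> r / ?N" for j
      proof -
        have "\<bar>x $ j - t $ j\<bar> \<le> (r / ?N) powr (1 / H $ j)"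
          using ku[OF k(1), of j] s1[of j] u0[of j] by (simp add: k(2) v_def abs_mult)
        then have "\<bar>x $ j - t $ j\<bar> powr (H $ j) \<le> ((r / ?N) powr (1 / H $ j)) powr (H $ j)"
          using H[of j] by (intro powr_mono2) auto
        also have "\<dots> = r / ?N" using H[of j] r by (simp add: powr_powr)
        finally show ?thesis .
      qed
      then have "rho H x t \<le> (\<Sum>j\<in>(UNIV :: 'n set). r / ?N)"
        unfolding rho_def by (intro sum_mono) auto
      then show "x \<in> B_rho H t r" by (simp add: B_rho_def)
    qed
    show "p powr (\<Sum>j\<in>UNIV. 1 / H $ j) \<le> card (v ` K)"
    proof -
      have "p powr (\<Sum>j\<in>UNIV. 1 / H $ j) = (\<Prod>j\<in>UNIV. p powr (1 / H $ j))"
        using p by (subst powr_sum) auto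
      also have "\<dots> \<le> (\<Prod>j\<in>UNIV. real (L j + 1))"
      proof (intro prod_mono conjI)
        fix j
        show "p powr (1 / H $ j) \<le> real (L j + 1)"
          unfolding L_def by linarith
      qed simp
      also have "\<dots> = card K" unfolding K_def by (subst card_PiE) auto
      finally show ?thesis by (simp add: card_image[OF inj])
    qed
    show "r / (CARD('n) * p) \<le> rho H s s'" if "s \<in> v ` K" "s' \<in> v ` K" "s \<noteq> s'" for s s'
      using that sep by auto
  qed
qed

text \<open>Two such points would be less than \<open>\<delta>\<close> apart. With \<open>z\<close>
  equal to \<open>t\<close> and to 0 it shows that the separation from both costs at most two grid
  points.\<close>

lemma card_close_points_le_1:
  assumes H: "\<And>j. 0 < H $ j \<and> H $ j < 1" and S: "finite S"
    and sep: "\<And>s s'. s \<in> S \<Longrightarrow> s' \<in> S \<Longrightarrow> s \<noteq> s' \<Longrightarrow> \<delta> \<le> rho H s s'"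
  shows "card {s\<in>S. rho H s z < \<delta> / 2} \<le> 1"
proof -
  have "s = s'" if "s \<in> S" "s' \<in> S" "rho H s z < \<delta> / 2" "rho H s' z < \<delta> / 2" for s s'
    using rho_triangle[of H s s' z] H sep[OF that(1,2)] that(3,4) rho_commute[of H s' z] by fastforce
  then show ?thesis using S card_le_Suc0_iff_eq[of "{s\<in>S. rho H s z < \<delta> / 2}"] by simp
qed

section \<open>Small balls of one component\<close>

lemma gaussian_field_integrable:
  fixes X :: "'t \<Rightarrow> 'a \<Rightarrow> 'v::euclidean_space"
  assumes g: "gaussian_field M X"
  shows "integrable M (X t)"
proof -
  have M: "prob_space M" using g by (simp add: gaussian_field_def)
  have "integrable M (\<lambda>\<omega>. X t \<omega> \<bullet> b)" for b
    unfolding inner_commute[of _ b] using gaussian_rv_integrable(1)[OF M g[unfolded gaussian_field_def, THEN conjunct2, THEN conjunct2,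
      rule_format, of "{t}" "\<lambda>_. b"]] by simp
  then have "integrable M (\<lambda>\<omega>. \<Sum>b\<in>Basis. (X t \<omega> \<bullet> b) *\<^sub>R b)"
    by (intro Bochner_Integration.integrable_sum integrable_scaleR_left) auto
  then show ?thesis by (simp add: euclidean_representation)
qed

lemma iid_copies_distr:
  assumes "iid_copies M X M' Y"
  shows "distr M (\<Pi>\<^sub>M t\<in>UNIV. borel) (\<lambda>\<omega> t. X t \<omega> $ i) = distr M' (\<Pi>\<^sub>M t\<in>UNIV. borel) (\<lambda>\<omega> t. Y t \<omega>)"
  using assms by (simp add: iid_copies_def)

lemma borel_measurable_vec_nth: "(\<lambda>x :: real ^ 'd. x $ i) \<in> borel_measurable borel"
  by (intro borel_measurable_continuous_onI linear_continuous_on bounded_linear_vec_nth)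

text \<open>Mean zero is assumed of \<open>X\<close>, while the Gaussian estimates are made for
  \<open>Y\<close> on its own space. The expectation at \<open>t\<close> depends only on the law on
  path space, through evaluation at \<open>t\<close>.\<close>

lemma iid_copies_mean_zero:
  fixes X :: "'t \<Rightarrow> 'a \<Rightarrow> real ^ 'd" and Y :: "'t \<Rightarrow> 'b \<Rightarrow> real"
  assumes X: "gaussian_field M X" "mean_zero_field M X" and Y: "gaussian_field M' Y"
    and iid: "iid_copies M X M' Y"
  shows "(\<integral>\<omega>. Y t \<omega> \<partial>M') = 0"
proof -
  let ?P = "(\<Pi>\<^sub>M t\<in>(UNIV :: 't set). borel) :: ('t \<Rightarrow> real) measure"
  let ?i = "undefined :: 'd"
  have [measurable]: "X t \<in> borel_measurable M" "Y t \<in> borel_measurable M'" for t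
    using X Y by (auto simp: gaussian_field_def)
  have mX: "(\<lambda>\<omega> t. X t \<omega> $ ?i) \<in> measurable M ?P"
    by (rule measurable_PiM_single') (auto intro: measurable_compose[OF _ borel_measurable_vec_nth])
  have mY: "(\<lambda>\<omega> t. Y t \<omega>) \<in> measurable M' ?P"
    by (rule measurable_PiM_single') auto
  have mc: "(\<lambda>f. f t) \<in> borel_measurable ?P" by (rule measurable_component_singleton) simp
  have "(\<integral>\<omega>. Y t \<omega> \<partial>M') = (\<integral>f. f t \<partial>distr M' ?P (\<lambda>\<omega> t. Y t \<omega>))"
    by (rule integral_distr[OF mY mc, symmetric])
  also have "\<dots> = (\<integral>f. f t \<partial>distr M ?P (\<lambda>\<omega> t. X t \<omega> $ ?i))"
    by (simp only: iid_copies_distr[OF iid])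
  also have "\<dots> = (\<integral>\<omega>. X t \<omega> $ ?i \<partial>M)"
    by (rule integral_distr[OF mX mc])
  also have "\<dots> = (\<integral>\<omega>. X t \<omega> \<partial>M) $ ?i"
    by (rule integral_bounded_linear[OF bounded_linear_vec_nth gaussian_field_integrable[OF X(1)]])
  also have "\<dots> = 0" using X(2) by (simp add: mean_zero_field_def)
  finally show ?thesis .
qed

text \<open>For finite \<open>S\<close> the event belongs to the product sigma-algebra, on which the
  laws agree. It carries estimates for \<open>Y\<close>, where condition (A) lives, over to the
  components of \<open>X\<close>.\<close>

lemma iid_copies_small_ball_eq:
  fixes X :: "'t \<Rightarrow> 'a \<Rightarrow> real ^ 'd" and Y :: "'t \<Rightarrow> 'b \<Rightarrow> real"
  assumes X: "gaussian_field M X" and Y: "gaussian_field M' Y"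
    and iid: "iid_copies M X M' Y" and S: "finite S"
  shows "measure M {\<omega>\<in>space M. \<forall>s\<in>S. \<bar>X s \<omega> $ i - X t \<omega> $ i\<bar> \<le> e}
    = measure M' {\<omega>\<in>space M'. \<forall>s\<in>S. \<bar>Y s \<omega> - Y t \<omega>\<bar> \<le> e}"
proof -
  let ?P = "(\<Pi>\<^sub>M t\<in>(UNIV :: 't set). borel) :: ('t \<Rightarrow> real) measure"
  have [measurable]: "X t \<in> borel_measurable M" "Y t \<in> borel_measurable M'" for t
    using X Y by (auto simp: gaussian_field_def)
  have mX: "(\<lambda>\<omega> t. X t \<omega> $ i) \<in> measurable M ?P"
    by (rule measurable_PiM_single') (auto intro: measurable_compose[OF _ borel_measurable_vec_nth])
  have mY: "(\<lambda>\<omega> t. Y t \<omega>) \<in> measurable M' ?P"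
    by (rule measurable_PiM_single') auto
  have mc[measurable]: "(\<lambda>f. f t) \<in> borel_measurable ?P" for t
    by (rule measurable_component_singleton) simp
  let ?A = "{f \<in> space ?P. \<forall>s\<in>S. \<bar>f s - f t\<bar> \<le> e}"
  have A: "?A \<in> sets ?P"
    by (rule sets.sets_Collect_finite_All[OF _ S]) measurable
  have "measure M' {\<omega>\<in>space M'. \<forall>s\<in>S. \<bar>Y s \<omega> - Y t \<omega>\<bar> \<le> e}
      = measure (distr M' ?P (\<lambda>\<omega> t. Y t \<omega>)) ?A"
    unfolding measure_distr[OF mY A]
    by (rule arg_cong[where f="measure M'"]) (auto simp: space_PiM)
  also have "\<dots> = measure (distr M ?P (\<lambda>\<omega> t. X t \<omega> $ i)) ?A"
    by (simp only: iid_copies_distr[OF iid])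
  also have "\<dots> = measure M {\<omega>\<in>space M. \<forall>s\<in>S. \<bar>X s \<omega> $ i - X t \<omega> $ i\<bar> \<le> e}"
    unfolding measure_distr[OF mX A]
    by (rule arg_cong[where f="measure M"]) (auto simp: space_PiM)
  finally show ?thesis by simp
qed

text \<open>The constants precede \<open>t\<close>, \<open>r\<close> and \<open>p\<close> because
  the union bound over nets needs the same ones at all centres and scales. The Q-th power of
  \<open>p\<close> governs the number of grid points and \<open>r / p\<close> their
  separation.\<close>

lemma small_ball_component:
  fixes X :: "real ^ 'n \<Rightarrow> 'a \<Rightarrow> real ^ 'd" and Y :: "real ^ 'n \<Rightarrow> 'b \<Rightarrow> real"
  assumes X: "gaussian_field M X" "mean_zero_field M X" and Y: "gaussian_field M' Y"
    and iid: "iid_copies M X M' Y"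
    and T: "bounded_interval T" and A: "condition_A M' Y H T"
  shows "\<exists>K>0. \<exists>r0>0. \<exists>p0. \<forall>t\<in>T. \<forall>r p. 0 < r \<longrightarrow> r < r0 \<longrightarrow> p0 \<le> p \<longrightarrow>
    (\<exists>S. finite S \<and> S \<subseteq> B_rho H t r \<and>
      measure M {\<omega>\<in>space M. \<forall>s\<in>S. \<bar>X s \<omega> $ i - X t \<omega> $ i\<bar> \<le> K * r / p}
        \<le> exp (- (p powr (\<Sum>j\<in>UNIV. 1 / H $ j)) / 2))"
proof -
  let ?Q = "\<Sum>j\<in>UNIV. 1 / H $ j"
  let ?N = "real CARD('n)"
  obtain a b where ab: "\<And>j. a $ j < b $ j" and Tab: "T = cbox a b \<or> T = box a b"
    using T unfolding bounded_interval_def by blast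
  have H: "\<And>j. 0 < H $ j \<and> H $ j < 1" using A by (simp add: condition_A_def)
  obtain C3 where C3: "0 < C3" and
    A2: "\<And>n t \<tau>. 1 \<le> n \<Longrightarrow> t \<in> T \<Longrightarrow> \<tau> 0 = 0 \<Longrightarrow> (\<forall>k\<in>{1..n}. \<tau> k \<in> T) \<Longrightarrow>
        AE \<omega> in M'. cond_variance M' (generated_algebra M' n (\<lambda>k. Y (\<tau> k))) (Y t) \<omega>
             \<ge> C3 * (MIN k\<in>{0..n::nat}. (rho H t (\<tau> k))\<^sup>2)"
    using A unfolding condition_A_def by blast
  have Q0: "0 < ?Q" using H by (intro sum_pos) auto
  \<comment> \<open>Chosen so that \<open>K * r / p\<close> is the threshold
    \<open>sqrt C3 * (\<delta> / 2) / exp (3 / 2)\<close> for the separation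
    \<open>\<delta> / 2 = r / (2 * ?N * p)\<close>.\<close>
  define K where "K = sqrt C3 / (2 * ?N * exp (3 / 2))"
  have K: "0 < K" using C3 by (simp add: K_def)
  have "\<forall>j. \<exists>d>0. \<forall>r. 0 < r \<longrightarrow> r < d \<longrightarrow> (r / ?N) powr (1 / H $ j) < (b $ j - a $ j) / 2"
  proof
    fix j
    let ?c = "(b $ j - a $ j) / 2"
    have c: "0 < ?c" using ab[of j] by simp
    have "(r / ?N) powr (1 / H $ j) < ?c" if "0 < r" "r < ?N * ?c powr (H $ j)" for r
    proof -
      have "r / ?N < ?c powr (H $ j)" using that by (simp add: field_simps)
      then have "(r / ?N) powr (1 / H $ j) < (?c powr (H $ j)) powr (1 / H $ j)"
        using H[of j] that by (intro powr_less_mono2) auto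
      also have "\<dots> = ?c powr 1" unfolding powr_powr using H[of j] by simp
      finally show ?thesis using c by simp
    qed
    moreover have "0 < ?N * ?c powr (H $ j)" using c by simp
    ultimately show "\<exists>d>0. \<forall>r. 0 < r \<longrightarrow> r < d \<longrightarrow> (r / ?N) powr (1 / H $ j) < ?c" by blast
  qed
  then obtain d where d: "\<And>j. 0 < d j" "\<And>j r. 0 < r \<Longrightarrow> r < d j \<Longrightarrow> (r / ?N) powr (1 / H $ j) < (b $ j - a $ j) / 2"
    by metis
  define r0 where "r0 = Min (range d)"
  have r0: "0 < r0" unfolding r0_def using d(1) by (subst Min_gr_iff) auto
  have small: "(r / ?N) powr (1 / H $ j) < (b $ j - a $ j) / 2" if "0 < r" "r < r0" for r j
    using that d(2)[of r j] by (simp add: r0_def)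
  \<comment> \<open>Ensures \<open>4 \<le> p powr ?Q\<close>: after the loss of two points at least
    \<open>p powr ?Q / 2\<close> remain.\<close>
  define p0 where "p0 = max 1 (4 powr (1 / ?Q))"
  have "\<exists>S. finite S \<and> S \<subseteq> B_rho H t r \<and>
      measure M {\<omega>\<in>space M. \<forall>s\<in>S. \<bar>X s \<omega> $ i - X t \<omega> $ i\<bar> \<le> K * r / p} \<le> exp (- (p powr ?Q) / 2)"
    if t: "t \<in> T" and r: "0 < r" "r < r0" and p: "p0 \<le> p" for t r p
  proof -
    have p1: "1 \<le> p" using p by (simp add: p0_def)
    have p4: "4 \<le> p powr ?Q"
    proof -
      have "4 = (4 powr (1 / ?Q)) powr ?Q" unfolding powr_powr using Q0 by simp
      also have "\<dots> \<le> p powr ?Q" using p Q0 by (intro powr_mono2) (auto simp: p0_def)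
      finally show ?thesis .
    qed
    obtain S0 where S0: "finite S0" "S0 \<subseteq> T" "S0 \<subseteq> B_rho H t r" "p powr ?Q \<le> card S0"
      "\<And>s s'. s \<in> S0 \<Longrightarrow> s' \<in> S0 \<Longrightarrow> s \<noteq> s' \<Longrightarrow> r / (?N * p) \<le> rho H s s'"
      using separated_grid[OF H Tab t r(1) small[OF r] p1] by blast
    define \<delta> where "\<delta> = r / (?N * p)"
    have \<delta>: "0 < \<delta>" using r p1 by (simp add: \<delta>_def)
    define S where "S = {s\<in>S0. \<delta> / 2 \<le> rho H s t \<and> \<delta> / 2 \<le> rho H s 0}"
    have fS: "finite S" using S0 by (simp add: S_def)
    have close: "card {s\<in>S0. rho H s z < \<delta> / 2} \<le> 1" for z
      by (rule card_close_points_le_1[OF H S0(1)]) (use S0(5) in \<open>auto simp: \<delta>_def\<close>)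
    have "S0 \<subseteq> S \<union> {s\<in>S0. rho H s t < \<delta> / 2} \<union> {s\<in>S0. rho H s 0 < \<delta> / 2}"
      by (auto simp: S_def)
    then have "card S0 \<le> card (S \<union> {s\<in>S0. rho H s t < \<delta> / 2} \<union> {s\<in>S0. rho H s 0 < \<delta> / 2})"
      using fS S0(1) by (intro card_mono) auto
    also have "\<dots> \<le> card S + card {s\<in>S0. rho H s t < \<delta> / 2} + card {s\<in>S0. rho H s 0 < \<delta> / 2}"
      by (meson card_Un_le order_trans add_le_mono1)
    finally have "card S0 \<le> card S + 2" using close[of t] close[of 0] by linarith
    then have cS: "p powr ?Q / 2 \<le> real (card S)" using S0(4) p4 by linarith
    obtain s where s: "bij_betw s {0..<card S} S" using ex_bij_betw_nat_finite[OF fS] by blast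
    have sS: "s k \<in> S" if "k < card S" for k using s that by (auto simp: bij_betw_def)
    have e: "K * r / p = sqrt C3 * (\<delta> / 2) / exp (3 / 2)"
      by (simp add: K_def \<delta>_def)
    have "measure M {\<omega>\<in>space M. \<forall>s\<in>S. \<bar>X s \<omega> $ i - X t \<omega> $ i\<bar> \<le> K * r / p}
      = measure M' {\<omega>\<in>space M'. \<forall>s\<in>S. \<bar>Y s \<omega> - Y t \<omega>\<bar> \<le> K * r / p}"
      by (rule iid_copies_small_ball_eq[OF X(1) Y iid fS])
    also have "\<dots> = measure M' {\<omega>\<in>space M'. \<forall>k<card S. \<bar>Y (s k) \<omega> - Y t \<omega>\<bar> \<le> sqrt C3 * (\<delta> / 2) / exp (3 / 2)}"
    proof -
      have "(\<forall>s\<in>S. P s) \<longleftrightarrow> (\<forall>k<card S. P (s k))" for P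
        using bij_betw_imp_surj_on[OF s] sS by (metis atLeastLessThan_iff imageE)
      then show ?thesis by (simp only: e)
    qed
    also have "\<dots> \<le> exp (- real (card S))"
    proof (rule small_ball_field[OF Y iid_copies_mean_zero[OF X Y iid] C3 A2 _ t])
      show "0 < \<delta> / 2" using \<delta> by simp
      show "s k \<in> T" "\<delta> / 2 \<le> rho H (s k) t" "\<delta> / 2 \<le> rho H (s k) 0" if "k < card S" for k
        using sS[OF that] S0(2) by (auto simp: S_def)
      show "\<delta> / 2 \<le> rho H (s k) (s j)" if "j < k" "k < card S" for j k
      proof -
        have "s k \<noteq> s j"
          using inj_on_eq_iff[OF bij_betw_imp_inj_on[OF s], of k j] that by simp
        then have "\<delta> \<le> rho H (s k) (s j)"
          using S0(5) sS[of k] sS[of j] that unfolding \<delta>_def S_def by auto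
        then show ?thesis using \<delta> by simp
      qed
    qed
    also have "\<dots> \<le> exp (- (p powr ?Q) / 2)" using cS by simp
    finally show ?thesis using fS S0(3) unfolding S_def by blast
  qed
  then show ?thesis
    by (intro exI[of _ K] exI[of _ r0] exI[of _ p0] conjI K r0 ballI allI impI)
qed

section \<open>Nets and Borel--Cantelli\<close>

text \<open>Points in one cell of a cubic grid are \<open>rho\<close>-close. The mesh
  \<open>w\<close> is tuned to the smallest exponent \<open>h\<close>, the worst one because
  \<open>w \<le> 1\<close>. Representatives are chosen inside the occupied cells, so that the net
  lies in \<open>T\<close>, where small-ball estimates are available.\<close>

lemma finite_rho_net:
  fixes H :: "real ^ 'n"
  assumes H: "\<And>j. 0 < H $ j \<and> H $ j < 1" and T: "bounded T"
  shows "\<exists>C>0. \<exists>l\<ge>1. \<forall>m::nat. \<exists>F. finite F \<and> F \<subseteq> T \<and>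
    (\<forall>t\<in>T. \<exists>t'\<in>F. rho H t t' \<le> (1/2) ^ m) \<and> real (card F) \<le> C * l ^ m"
proof -
  let ?N = "real CARD('n)"
  obtain B where B: "0 < B" "\<And>t. t \<in> T \<Longrightarrow> norm t \<le> B"
    using T by (auto simp: bounded_pos)
  define h where "h = Min (range (\<lambda>j. H $ j))"
  have h0: "0 < h" unfolding h_def using H by (subst Min_gr_iff) auto
  have hH: "h \<le> H $ j" for j by (simp add: h_def)
  \<comment> \<open>\<open>C\<close> and \<open>l\<close> are read off from at most
    \<open>(2 * B + 3) / w\<close> cells per coordinate, where
    \<open>1 / w = (?N * 2 ^ m) powr (1 / h)\<close>.\<close>
  define C where "C = ((2 * B + 3) * ?N powr (1 / h)) ^ CARD('n)"
  define l where "l = ((2::real) powr (1 / h)) ^ CARD('n)"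
  have C: "0 < C" using B by (simp add: C_def)
  have l: "1 \<le> l" unfolding l_def using h0 by (intro one_le_power ge_one_powr_ge_zero) auto
  have "\<exists>F. finite F \<and> F \<subseteq> T \<and> (\<forall>t\<in>T. \<exists>t'\<in>F. rho H t t' \<le> (1/2) ^ m) \<and> real (card F) \<le> C * l ^ m"
    for m :: nat
  proof -
    define w where "w = ((1/2) ^ m / ?N) powr (1 / h)"
    have w0: "0 < w" by (simp add: w_def)
    have N1: "1 \<le> ?N" by (simp add: Suc_leI)
    have "(1/2::real) ^ m \<le> 1" by (rule power_le_one) auto
    then have "(1/2) ^ m \<le> ?N" using N1 by linarith
    then have q1: "(1/2) ^ m / ?N \<le> 1" by (simp add: divide_le_eq)
    have w1: "w \<le> 1" unfolding w_def using h0 q1 by (intro powr_le1) auto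
    have wh: "w powr h = (1/2) ^ m / ?N" unfolding w_def powr_powr using h0 by simp
    define g where "g t = (\<lambda>j. \<lfloor>t $ j / w\<rfloor>)" for t :: "real ^ 'n"
    have close: "rho H t t' \<le> (1/2) ^ m" if "g t = g t'" for t t'
    proof -
      have "\<bar>t $ j - t' $ j\<bar> powr (H $ j) \<le> (1/2) ^ m / ?N" for j
      proof -
        have "\<lfloor>t $ j / w\<rfloor> = \<lfloor>t' $ j / w\<rfloor>" using fun_cong[OF that, of j] by (simp add: g_def)
        then have "\<bar>t $ j / w - t' $ j / w\<bar> \<le> 1" by linarith
        then have d: "\<bar>t $ j - t' $ j\<bar> \<le> w"
          using w0 by (simp add: diff_divide_distrib[symmetric] abs_divide)
        have "\<bar>t $ j - t' $ j\<bar> powr (H $ j) \<le> w powr (H $ j)"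
          using H[of j] d by (intro powr_mono2) auto
        also have "\<dots> \<le> w powr h" using hH w0 w1 by (intro powr_mono') auto
        finally show ?thesis by (simp add: wh)
      qed
      then have "rho H t t' \<le> (\<Sum>j\<in>(UNIV :: 'n set). (1/2) ^ m / ?N)"
        unfolding rho_def by (intro sum_mono) auto
      then show ?thesis by simp
    qed
    define b where "b = \<lceil>B / w\<rceil>"
    have "0 \<le> B / w" using B(1) w0 by simp
    then have b0: "0 \<le> b" unfolding b_def by linarith
    have sub: "g ` T \<subseteq> PiE UNIV (\<lambda>_. {-b..b})"
    proof
      fix v assume "v \<in> g ` T"
      then obtain t where t: "t \<in> T" "v = g t" by blast
      have "v j \<in> {-b..b}" for j
      proof -
        have "\<bar>t $ j\<bar> \<le> B" using component_le_norm_cart[of t j] B(2)[OF t(1)] by linarith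
        then have "\<bar>t $ j / w\<bar> \<le> B / w" using w0 by (simp add: abs_divide divide_right_mono)
        then show ?thesis unfolding t(2) g_def b_def by (simp, linarith)
      qed
      then show "v \<in> PiE UNIV (\<lambda>_. {-b..b})" by auto
    qed
    have finP: "finite (PiE (UNIV :: 'n set) (\<lambda>_. {-b..b}))" by (intro finite_PiE) auto
    define c where "c v = (SOME t. t \<in> T \<and> g t = v)" for v
    have c: "c v \<in> T \<and> g (c v) = v" if "v \<in> g ` T" for v
      unfolding c_def by (rule someI_ex) (use that in auto)
    have fin: "finite (g ` T)" using sub finP by (rule finite_subset)
    show ?thesis
    proof (intro exI[of _ "c ` g ` T"] conjI ballI)
      show "finite (c ` g ` T)" using fin by simp
      show "c ` g ` T \<subseteq> T" using c by auto
      show "\<exists>t'\<in>c ` g ` T. rho H t t' \<le> (1/2) ^ m" if "t \<in> T" for t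
        using close[of t "c (g t)"] c[of "g t"] that by auto
      have "card (c ` g ` T) \<le> card (g ` T)" using fin by (rule card_image_le)
      also have "\<dots> \<le> card (PiE (UNIV :: 'n set) (\<lambda>_. {-b..b}))" using finP sub by (rule card_mono)
      also have "\<dots> = nat (2 * b + 1) ^ CARD('n)" by (subst card_PiE) auto
      finally have "real (card (c ` g ` T)) \<le> real (nat (2 * b + 1) ^ CARD('n))" by (rule of_nat_mono)
      also have "\<dots> = (2 * real_of_int b + 1) ^ CARD('n)" using b0 by simp
      also have "\<dots> \<le> ((2 * B + 3) / w) ^ CARD('n)"
      proof (rule power_mono)
        have "real_of_int b \<le> B / w + 1" unfolding b_def by linarith
        moreover have "1 \<le> 1 / w" using w0 w1 by simp
        ultimately have "2 * real_of_int b + 1 \<le> 2 * (B / w) + 3 * (1 / w)" by linarith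
        then show "2 * real_of_int b + 1 \<le> (2 * B + 3) / w" by (simp add: add_divide_distrib)
        show "0 \<le> 2 * real_of_int b + 1" using b0 by simp
      qed
      also have "(2 * B + 3) / w = ((2 * B + 3) * ?N powr (1 / h)) * (2 powr (1 / h)) ^ m"
      proof -
        have "1 / w = (?N * 2 ^ m) powr (1 / h)"
          unfolding w_def powr_divide[symmetric]
          by (simp add: powr_divide powr_mult power_one_over field_simps)
        also have "\<dots> = ?N powr (1 / h) * (2 powr (1 / h)) ^ m"
          by (simp add: powr_mult powr_power powr_realpow[symmetric] powr_powr mult.commute)
        finally show ?thesis by (simp add: divide_inverse)
      qed
      also have "(\<dots>) ^ CARD('n) = C * l ^ m"
        unfolding C_def l_def power_mult_distrib by (simp add: power_mult[symmetric] mult.commute)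
      finally show "real (card (c ` g ` T)) \<le> C * l ^ m" .
    qed
  qed
  then show ?thesis using C l by blast
qed

text \<open>A small oscillation around \<open>t\<close> forces a small oscillation around the nearest point of the net,
  because that point itself lies in the doubled ball around \<open>t\<close>. Hence no modulus of continuity is
  needed to pass from the net to all of \<open>T0\<close>.\<close>

lemma AE_eventually_oscillation:
  fixes Z :: "real ^ 'n \<Rightarrow> 'a \<Rightarrow> real"
  assumes M: "prob_space M" and Z: "\<And>t. Z t \<in> borel_measurable M"
    and H: "\<And>j. 0 < H $ j \<and> H $ j < 1" and Q: "0 < Q" and r0: "0 < r0"
    and SB: "\<And>t r p. t \<in> T \<Longrightarrow> 0 < r \<Longrightarrow> r < r0 \<Longrightarrow> p0 \<le> p \<Longrightarrow>
      \<exists>S. finite S \<and> S \<subseteq> B_rho H t r \<and>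
        measure M {\<omega>\<in>space M. \<forall>s\<in>S. \<bar>Z s \<omega> - Z t \<omega>\<bar> \<le> K * r / p} \<le> exp (- (p powr Q) / 2)"
    and F: "\<And>m. finite (F m)" "\<And>m. F m \<subseteq> T"
      "\<And>m t. t \<in> T0 \<Longrightarrow> \<exists>t'\<in>F m. rho H t t' \<le> (1/2) ^ m"
    and q: "filterlim q at_top sequentially"
    and sum: "summable (\<lambda>m. real (card (F m)) * exp (- q m / 2))"
  shows "AE \<omega> in M. \<forall>\<^sub>F m in sequentially. \<forall>t\<in>T0. \<exists>s\<in>B_rho H t (2 * (1/2) ^ m).
    K / 2 * (1/2) ^ m * q m powr (- 1 / Q) \<le> \<bar>Z s \<omega> - Z t \<omega>\<bar>"
proof -
  interpret prob_space M by fact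
  note [measurable] = Z
  \<comment> \<open>Two numbers more than \<open>x\<close> apart cannot both be closer than
    \<open>x / 2\<close> to a third. It is applied to the values at \<open>s\<close> and
    \<open>t'\<close> seen from \<open>t\<close>, and it turns \<open>K\<close> into
    \<open>K / 2\<close>.\<close>
  have half: "x / 2 \<le> \<bar>a - c\<bar> \<or> x / 2 \<le> \<bar>b - c\<bar>" if "x < \<bar>a - b\<bar>" for x a b c :: real
    using that by linarith
  \<comment> \<open>Makes the exponent \<open>p m powr Q\<close> of the small-ball bound equal to
    \<open>q m\<close>.\<close>
  define p where "p m = q m powr (1 / Q)" for m
  have "\<forall>\<^sub>F m in sequentially. (1/2::real) ^ m < r0"
    using r0 by (intro order_tendstoD(2)[OF LIMSEQ_power_zero]) auto
  moreover have "\<forall>\<^sub>F m in sequentially. 1 \<le> q m"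
    using q by (auto simp: filterlim_at_top)
  moreover have "\<forall>\<^sub>F m in sequentially. max 1 p0 powr Q \<le> q m"
    using q by (auto simp: filterlim_at_top)
  ultimately have "\<forall>\<^sub>F m in sequentially. (1/2) ^ m < r0 \<and> 1 \<le> q m \<and> max 1 p0 powr Q \<le> q m"
    by eventually_elim auto
  then obtain m0 where m0: "\<And>m. m0 \<le> m \<Longrightarrow> (1/2) ^ m < r0 \<and> 1 \<le> q m \<and> max 1 p0 powr Q \<le> q m"
    by (auto simp: eventually_sequentially)
  have pQ: "p m powr Q = q m" "p0 \<le> p m" "0 < p m" if "m0 \<le> m" for m
  proof -
    show "p m powr Q = q m" unfolding p_def powr_powr using Q m0[OF that] by simp
    have "max 1 p0 = (max 1 p0 powr Q) powr (1 / Q)" unfolding powr_powr using Q by simp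
    also have "\<dots> \<le> p m" unfolding p_def using Q m0[OF that] by (intro powr_mono2) auto
    finally show "p0 \<le> p m" "0 < p m" by auto
  qed
  define E where "E m t S = {\<omega>\<in>space M. \<forall>s\<in>S. \<bar>Z s \<omega> - Z t \<omega>\<bar> \<le> K * (1/2) ^ m / p m}" for m t S
  have "\<exists>S. finite S \<and> S \<subseteq> B_rho H t ((1/2) ^ m) \<and> measure M (E m t S) \<le> exp (- q m / 2)"
    if "m0 \<le> m" "t \<in> F m" for m t
    unfolding E_def pQ(1)[OF that(1), symmetric]
    by (rule SB) (use that F(2) m0 pQ in auto)
  then obtain S where S: "\<And>m t. m0 \<le> m \<Longrightarrow> t \<in> F m \<Longrightarrow> finite (S m t)"
    "\<And>m t. m0 \<le> m \<Longrightarrow> t \<in> F m \<Longrightarrow> S m t \<subseteq> B_rho H t ((1/2) ^ m)"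
    "\<And>m t. m0 \<le> m \<Longrightarrow> t \<in> F m \<Longrightarrow> measure M (E m t (S m t)) \<le> exp (- q m / 2)"
    by metis
  \<comment> \<open>Below \<open>m0\<close> no sets \<open>S m t\<close> were specified, so the bad
    event is taken empty there to keep it measurable; Borel-Cantelli ignores finitely many
    indices.\<close>
  define A where "A m = (if m0 \<le> m then \<Union>t\<in>F m. E m t (S m t) else {})" for m
  have Em: "E m t (S m t) \<in> sets M" if "m0 \<le> m" "t \<in> F m" for m t
    unfolding E_def by (rule sets.sets_Collect_finite_All) (use S(1)[OF that] in auto)
  have Am: "A m \<in> sets M" for m
    unfolding A_def using Em F(1) by (auto intro!: sets.finite_UN)
  have "AE \<omega> in M. \<forall>\<^sub>F m in sequentially. \<omega> \<in> space M - A m"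
  proof (rule borel_cantelli_AE1[OF Am])
    show "emeasure M (A m) < \<infinity>" for m by (simp add: less_top[symmetric])
    show "summable (\<lambda>m. measure M (A m))"
    proof (rule summable_comparison_test[OF exI[of _ m0] sum], intro allI impI)
      fix m assume m: "m0 \<le> m"
      have "measure M (A m) \<le> (\<Sum>t\<in>F m. measure M (E m t (S m t)))"
        unfolding A_def using m Em F(1) by (auto intro!: finite_measure_subadditive_finite)
      also have "\<dots> \<le> (\<Sum>t\<in>F m. exp (- q m / 2))"
        using S(3)[OF m] by (intro sum_mono) auto
      finally show "norm (measure M (A m)) \<le> real (card (F m)) * exp (- q m / 2)" by simp
    qed
  qed
  then show ?thesis
  proof (rule AE_mp, intro AE_I2 impI)
    fix \<omega> assume "\<omega> \<in> space M" and "\<forall>\<^sub>F m in sequentially. \<omega> \<in> space M - A m"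
    from this(2) eventually_ge_at_top[of m0]
    show "\<forall>\<^sub>F m in sequentially. \<forall>t\<in>T0. \<exists>s\<in>B_rho H t (2 * (1/2) ^ m).
      K / 2 * (1/2) ^ m * q m powr (- 1 / Q) \<le> \<bar>Z s \<omega> - Z t \<omega>\<bar>"
    proof eventually_elim
      case (elim m)
      show ?case
      proof
        fix t assume "t \<in> T0"
        then obtain t' where t': "t' \<in> F m" "rho H t t' \<le> (1/2) ^ m" using F(3) by blast
        have "\<omega> \<notin> E m t' (S m t')" using elim t' by (auto simp: A_def)
        then obtain s where s: "s \<in> S m t'" "K * (1/2) ^ m / p m < \<bar>Z s \<omega> - Z t' \<omega>\<bar>"
          using elim(1) by (auto simp: E_def not_le)
        have "rho H s t' \<le> (1/2) ^ m" using S(2)[OF elim(2) t'(1)] s(1) by (auto simp: B_rho_def)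
        then have "rho H s t \<le> 2 * (1/2) ^ m"
          using rho_triangle[of H s t t'] H t'(2) rho_commute[of H t t'] by fastforce
        moreover have "rho H t' t \<le> 2 * (1/2) ^ m"
        proof -
          have "0 \<le> (1/2::real) ^ m" by simp
          then show ?thesis using t'(2) rho_commute[of H t t'] by linarith
        qed
        moreover have "K * (1/2) ^ m / p m = K * (1/2) ^ m * q m powr (- 1 / Q)"
          by (simp add: p_def powr_minus_divide)
        then have e: "K / 2 * (1/2) ^ m * q m powr (- 1 / Q) = (K * (1/2) ^ m / p m) / 2"
          by simp
        have "K / 2 * (1/2) ^ m * q m powr (- 1 / Q) \<le> \<bar>Z s \<omega> - Z t \<omega>\<bar> \<or>
            K / 2 * (1/2) ^ m * q m powr (- 1 / Q) \<le> \<bar>Z t' \<omega> - Z t \<omega>\<bar>"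
          unfolding e by (rule half[OF s(2)])
        ultimately show "\<exists>s\<in>B_rho H t (2 * (1/2) ^ m). K / 2 * (1/2) ^ m * q m powr (- 1 / Q) \<le> \<bar>Z s \<omega> - Z t \<omega>\<bar>"
          by (auto simp: B_rho_def)
      qed
    qed
  qed
qed

text \<open>These windows are disjoint and adjacent, so every small \<open>r\<close> falls into one
  of them; the left end is the radius of the doubled ball of level \<open>m\<close>.\<close>

lemma eventually_at_right_of_dyadic:
  assumes "\<forall>\<^sub>F m in sequentially. \<forall>r. 2 * (1/2) ^ m \<le> r \<longrightarrow> r < 4 * (1/2) ^ m \<longrightarrow> P r"
  shows "\<forall>\<^sub>F r::real in at_right 0. P r"
proof -
  obtain m0 where m0: "\<And>m r. m0 \<le> m \<Longrightarrow> 2 * (1/2) ^ m \<le> r \<Longrightarrow> r < 4 * (1/2) ^ m \<Longrightarrow> P r"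
    using assms by (auto simp: eventually_sequentially)
  have "P r" if r: "0 < r" "r < 2 * (1/2) ^ m0" for r
  proof -
    define m where "m = nat \<lceil>log 2 (2 / r)\<rceil>"
    have "2 powr real m0 \<le> 2 / r" using r by (simp add: powr_realpow power_one_over field_simps)
    then have l: "real m0 \<le> log 2 (2 / r)" using r by (simp add: le_log_iff)
    have m: "log 2 (2 / r) \<le> real m" "real m < log 2 (2 / r) + 1" unfolding m_def using l by linarith+
    have 1: "2 / r \<le> 2 ^ m" using m(1) r by (simp add: log_le_iff powr_realpow)
    have "2 powr (real m - 1) < 2 / r" using m(2) r by (simp add: less_log_iff[symmetric])
    then have 2: "2 ^ m < 4 / r" by (simp add: powr_diff powr_realpow)
    show ?thesis
    proof (rule m0)
      show "m0 \<le> m" using l m(1) by linarith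
      show "2 * (1/2) ^ m \<le> r" using 1 r by (simp add: power_one_over field_simps)
      show "r < 4 * (1/2) ^ m" using 2 r by (simp add: power_one_over field_simps)
    qed
  qed
  then show ?thesis
    unfolding eventually_at_right_field by (intro exI[of _ "2 * (1/2) ^ m0"]) auto
qed

text \<open>Here \<open>q\<close> is the logarithmic scale along dyadic radii and \<open>h\<close>
  the one demanded in \<open>r\<close>. Within a window the ball only grows,
  \<open>r / 4 \<le> (1/2) ^ m\<close> costs the factor 4, and
  \<open>q m \<le> \<beta> * h r\<close> under the negative exponent \<open>- 1 / Q\<close> costs
  the power of \<open>\<beta>\<close>.\<close>

lemma eventually_at_right_oscillation:
  fixes D :: "real ^ 'n \<Rightarrow> real ^ 'n \<Rightarrow> real"
  assumes osc: "\<forall>\<^sub>F m in sequentially. \<forall>t\<in>T0. \<exists>s\<in>B_rho H t (2 * (1/2) ^ m).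
      c * (1/2) ^ m * q m powr (- 1 / Q) \<le> D s t"
    and c: "0 < c" and \<beta>: "0 < \<beta>" and Q: "0 < Q"
    and h: "\<forall>\<^sub>F m in sequentially. \<forall>r. 0 < r \<longrightarrow> r < 4 * (1/2) ^ m \<longrightarrow> 0 < q m \<and> q m \<le> \<beta> * h r"
  shows "\<forall>\<^sub>F r in at_right 0. \<forall>t\<in>T0. \<exists>s\<in>B_rho H t r.
      c / 4 * \<beta> powr (- 1 / Q) \<le> D s t / (r * h r powr (- 1 / Q))"
proof (rule eventually_at_right_of_dyadic, use osc h in eventually_elim, intro allI impI ballI)
  fix m and r :: real and t
  assume osc: "\<forall>t\<in>T0. \<exists>s\<in>B_rho H t (2 * (1/2) ^ m). c * (1/2) ^ m * q m powr (- 1 / Q) \<le> D s t"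
    and h: "\<forall>r. 0 < r \<longrightarrow> r < 4 * (1/2) ^ m \<longrightarrow> 0 < q m \<and> q m \<le> \<beta> * h r"
    and r: "2 * (1/2) ^ m \<le> r" "r < 4 * (1/2) ^ m" and t: "t \<in> T0"
  have "0 < 2 * (1/2::real) ^ m" by simp
  then have r0: "0 < r" using r(1) by linarith
  have q: "0 < q m" "q m \<le> \<beta> * h r" using h r0 r(2) by auto
  have "0 < \<beta> * h r" using q by linarith
  then have h0: "0 < h r" using \<beta> by (simp add: zero_less_mult_iff)
  obtain s where s: "s \<in> B_rho H t (2 * (1/2) ^ m)" "c * (1/2) ^ m * q m powr (- 1 / Q) \<le> D s t"
    using osc t by blast
  have "c / 4 * \<beta> powr (- 1 / Q) * (r * h r powr (- 1 / Q)) = c * (r / 4) * (\<beta> * h r) powr (- 1 / Q)"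
    using \<beta> h0 by (simp add: powr_mult)
  also have "\<dots> \<le> c * (1/2) ^ m * q m powr (- 1 / Q)"
    using c r r0 q Q by (intro mult_mono powr_mono2') auto
  also have "\<dots> \<le> D s t" by (rule s(2))
  finally have "c / 4 * \<beta> powr (- 1 / Q) \<le> D s t / (r * h r powr (- 1 / Q))"
    using r0 h0 by (simp add: pos_le_divide_eq)
  moreover have "s \<in> B_rho H t r" using s(1) r(1) by (simp add: B_rho_def)
  ultimately show "\<exists>s\<in>B_rho H t r. c / 4 * \<beta> powr (- 1 / Q) \<le> D s t / (r * h r powr (- 1 / Q))"
    by blast
qed

section \<open>Oscillation and differentiability\<close>

lemma ln_inverse_ge_of_less_dyadic:
  fixes r :: real
  assumes "0 < r" "r < 4 * (1/2) ^ m"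
  shows "(real m - 2) * ln 2 \<le> ln (1 / r)"
proof -
  have "ln r \<le> ln (4 * (1/2) ^ m)" using assms by simp
  also have "\<dots> = ln 4 - real m * ln 2"
    by (simp add: ln_mult ln_realpow ln_div)
  also have "ln 4 = 2 * ln (2 :: real)"
    using ln_realpow[of "2::real" 2] by simp
  finally show ?thesis using assms(1) by (simp add: ln_div algebra_simps)
qed

text \<open>The family \<open>T0\<close> lets one statement serve both bounds: a singleton for the
  pointwise one, \<open>T\<close> for the uniform one. \<open>D\<close> will be the oscillation of
  one component and \<open>E\<close> that of the vector; in \<open>ereal\<close> the suprema exist
  without any boundedness.\<close>

lemma Liminf_INF_SUP_ge:
  assumes ev: "\<forall>\<^sub>F r in at_right 0. \<forall>t\<in>T0. \<exists>s\<in>B t r. C \<le> D s t / (r * g r)"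
    and le: "\<And>s t. D s t \<le> E s t" and g: "\<And>r. 0 \<le> g r"
  shows "ereal C \<le> Liminf (at_right 0) (\<lambda>r::real. INF t\<in>T0. SUP s\<in>B t r. ereal (E s t / (r * g r)))"
proof (rule Liminf_bounded, use ev eventually_at_right_less[of 0] in eventually_elim, rule INF_greatest)
  fix r :: real and t
  assume "\<forall>t\<in>T0. \<exists>s\<in>B t r. C \<le> D s t / (r * g r)" and r: "0 < r" and "t \<in> T0"
  then obtain s where s: "s \<in> B t r" "C \<le> D s t / (r * g r)" by blast
  note s(2)
  also have "D s t / (r * g r) \<le> E s t / (r * g r)"
    using le r g[of r] by (intro divide_right_mono) auto
  finally have "ereal C \<le> ereal (E s t / (r * g r))" by simp
  then show "ereal C \<le> (SUP s\<in>B t r. ereal (E s t / (r * g r)))"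
    by (rule SUP_upper2[OF s(1)])
qed

text \<open>The ball has half-width at most \<open>r powr (1 / H $ j)\<close> in coordinate
  \<open>j\<close>, and \<open>r \<le> 1\<close> makes the largest exponent the worst. With
  \<open>h < 1\<close> its Euclidean size is of smaller order than \<open>r\<close>.\<close>

lemma norm_diff_le_of_in_B_rho:
  fixes H s t :: "real ^ 'n"
  assumes s: "s \<in> B_rho H t r" and r: "r \<le> 1"
    and H: "\<And>j. 0 < H $ j" "\<And>j. H $ j \<le> h"
  shows "norm (s - t) \<le> CARD('n) * r powr (1 / h)"
proof -
  have "\<bar>(s - t) $ j\<bar> \<le> r powr (1 / h)" for j
  proof -
    have "\<bar>s $ j - t $ j\<bar> powr (H $ j) \<le> rho H s t"
      unfolding rho_def by (rule member_le_sum) auto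
    also have "\<dots> \<le> r" using s by (simp add: B_rho_def)
    finally have *: "\<bar>s $ j - t $ j\<bar> powr (H $ j) \<le> r" .
    then have r0: "0 \<le> r" using powr_ge_zero order_trans by blast
    have "\<bar>s $ j - t $ j\<bar> = (\<bar>s $ j - t $ j\<bar> powr (H $ j)) powr (1 / H $ j)"
      unfolding powr_powr using H(1)[of j] by simp
    also have "\<dots> \<le> r powr (1 / H $ j)"
      using * H(1)[of j] by (intro powr_mono2) auto
    also have "\<dots> \<le> r powr (1 / h)"
      using H[of j] r r0 by (intro powr_mono' divide_left_mono) auto
    finally show ?thesis by simp
  qed
  then have "(\<Sum>j\<in>UNIV. \<bar>(s - t) $ j\<bar>) \<le> (\<Sum>j\<in>(UNIV :: 'n set). r powr (1 / h))"
    by (intro sum_mono) auto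
  then show ?thesis using norm_le_l1_cart[of "s - t"] by simp
qed

text \<open>Near \<open>t\<close> a differentiable function has increments of the order of the
  Euclidean distance, hence of order \<open>r powr \<alpha>\<close> with \<open>\<alpha> > 1\<close>
  on the \<open>rho\<close>-ball. The surplus factor \<open>r powr (\<alpha> - 1)\<close> beats
  every power of the logarithm.\<close>

lemma not_differentiable_of_oscillation:
  fixes f :: "real ^ 'n \<Rightarrow> 'v::real_normed_vector" and H :: "real ^ 'n"
  assumes H: "\<And>j. 0 < H $ j \<and> H $ j < 1" and C: "0 < C" and Q: "0 < Q"
    and ev: "\<forall>\<^sub>F r in at_right 0. \<exists>s\<in>B_rho H t r.
      C \<le> norm (f s - f t) / (r * ln (1 / r) powr (- 1 / Q))"
  shows "\<not> f differentiable (at t)"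
proof
  assume "f differentiable (at t)"
  then obtain f' where f': "(f has_derivative f') (at t)" by (auto simp: differentiable_def)
  then interpret f': bounded_linear f' by (rule has_derivative_bounded_linear)
  obtain B where B: "0 < B" "\<And>x. norm (f' x) \<le> norm x * B" using f'.pos_bounded by blast
  \<comment> \<open>Tolerance 1 in the derivative suffices: only a Lipschitz bound at the point
    \<open>t\<close>, with constant \<open>B + 1\<close>, is wanted.\<close>
  obtain d where d: "0 < d" "\<And>y. norm (y - t) < d \<Longrightarrow> norm (f y - f t - f' (y - t)) \<le> 1 * norm (y - t)"
    using f' unfolding has_derivative_at_alt by (metis zero_less_one)
  define L where "L = (B + 1) * CARD('n)"
  have L: "0 < L" using B(1) by (simp add: L_def)
  \<comment> \<open>A maximum over finitely many coordinates stays strictly below 1, which gives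
    \<open>\<alpha> > 1\<close>.\<close>
  define h where "h = Max (range (\<lambda>j. H $ j))"
  have hH: "H $ j \<le> h" for j by (simp add: h_def)
  have h0: "0 < h" using H hH by (meson order_less_le_trans)
  have h1: "h < 1" unfolding h_def using H by (subst Max_less_iff) auto
  define \<alpha> where "\<alpha> = 1 / h"
  have \<alpha>: "1 < \<alpha>" using h0 h1 by (simp add: \<alpha>_def)
  have lim1: "((\<lambda>r. CARD('n) * r powr \<alpha>) \<longlongrightarrow> 0) (at_right 0)" using \<alpha> by real_asymp
  have "((\<lambda>r. L * (r powr (\<alpha> - 1) * ln (1 / r) powr (1 / Q))) \<longlongrightarrow> 0) (at_right 0)"
    using \<alpha> Q by real_asymp
  then have lim2: "\<forall>\<^sub>F r in at_right 0. L * (r powr (\<alpha> - 1) * ln (1 / r) powr (1 / Q)) < C"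
    using C by (rule order_tendstoD)
  have "\<forall>\<^sub>F r::real in at_right 0. r < 1"
    by (intro eventually_at_right_real[THEN eventually_mono, of 0 1]) auto
  with ev lim2 eventually_at_right_less[of 0] order_tendstoD(2)[OF lim1 d(1)]
  have "\<forall>\<^sub>F r::real in at_right 0. False"
  proof eventually_elim
    case (elim r)
    then obtain s where s: "s \<in> B_rho H t r" "C \<le> norm (f s - f t) / (r * ln (1 / r) powr (- 1 / Q))"
      by blast
    have r: "0 < r" "r < 1" using elim by auto
    have l: "0 < ln (1 / r)" using r by simp
    have n: "norm (s - t) \<le> CARD('n) * r powr \<alpha>"
      unfolding \<alpha>_def by (rule norm_diff_le_of_in_B_rho[OF s(1)]) (use r H hH in auto)
    then have "norm (s - t) < d" using elim by linarith
    then have "norm (f s - f t - f' (s - t)) \<le> norm (s - t)" using d(2)[of s] by simp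
    then have "norm (f s - f t) \<le> norm (f' (s - t)) + norm (s - t)"
      using norm_triangle_ineq[of "f s - f t - f' (s - t)" "f' (s - t)"] by simp
    also have "\<dots> \<le> (B + 1) * norm (s - t)" using B(2)[of "s - t"] by (simp add: algebra_simps)
    also have "\<dots> \<le> (B + 1) * (CARD('n) * r powr \<alpha>)" using n B(1) by (intro mult_left_mono) auto
    finally have "norm (f s - f t) \<le> L * r powr \<alpha>" by (simp add: L_def mult.assoc)
    then have "norm (f s - f t) / (r * ln (1 / r) powr (- 1 / Q))
        \<le> L * r powr \<alpha> / (r * ln (1 / r) powr (- 1 / Q))"
      using r by (intro divide_right_mono) auto
    also have "\<dots> = L * (r powr (\<alpha> - 1) * ln (1 / r) powr (1 / Q))"
      using r l by (simp add: powr_diff powr_minus_divide)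
    finally show False using s(2) elim by linarith
  qed
  then show False by simp
qed

theorem theorem3p3:
  fixes M :: "'a measure" and M' :: "'b measure"
    and X :: "real ^ 'n \<Rightarrow> 'a \<Rightarrow> real ^ 'd"
    and Y :: "real ^ 'n \<Rightarrow> 'b \<Rightarrow> real"
    and H :: "real ^ 'n" and T :: "(real ^ 'n) set" and Q :: real
  assumes "gaussian_field M X" and "mean_zero_field M X" and "continuous_field M X"
    and "gaussian_field M' Y" and "iid_copies M X M' Y"
    and "bounded_interval T" and "condition_A M' Y H T"
    and "Q = (\<Sum>j\<in>UNIV. 1 / H $ j)"
  shows "(\<exists>C>0. \<exists>C'>0.
      (\<forall>t\<in>T. AE \<omega> in M.
         Liminf (at_right 0) (\<lambda>r::real. SUP s\<in>B_rho H t r.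
           ereal (norm (X s \<omega> - X t \<omega>) / (r * ln (ln (1 / r)) powr (- 1 / Q)))) \<ge> ereal C) \<and>
      (AE \<omega> in M.
         Liminf (at_right 0) (\<lambda>r::real. INF t\<in>T. SUP s\<in>B_rho H t r.
           ereal (norm (X s \<omega> - X t \<omega>) / (r * ln (1 / r) powr (- 1 / Q)))) \<ge> ereal C')) \<and>
    (AE \<omega> in M. \<forall>t\<in>T. \<not> (\<lambda>s. X s \<omega>) differentiable (at t))"
proof -
  \<comment> \<open>An arbitrary component; the index type is nonempty.\<close>
  let ?i = "undefined :: 'd"
  let ?D = "\<lambda>\<omega> s t. \<bar>X s \<omega> $ ?i - X t \<omega> $ ?i\<bar>"
  have M: "prob_space M" and X: "X t \<in> borel_measurable M" for t
    using assms(1) by (auto simp: gaussian_field_def)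
  have Z: "(\<lambda>\<omega>. X t \<omega> $ ?i) \<in> borel_measurable M" for t
    by (rule measurable_compose[OF X borel_measurable_vec_nth])
  have H: "0 < H $ j \<and> H $ j < 1" for j using assms(7) by (simp add: condition_A_def)
  have Q: "0 < Q" unfolding assms(8) using H by (intro sum_pos) auto
  have D: "?D \<omega> s t \<le> norm (X s \<omega> - X t \<omega>)" for \<omega> s t
    using component_le_norm_cart[of "X s \<omega> - X t \<omega>" ?i] by simp
  obtain K r0 p0 where K: "0 < K" and r0: "0 < r0" and SB: "\<forall>t\<in>T. \<forall>r p. 0 < r \<longrightarrow> r < r0 \<longrightarrow> p0 \<le> p \<longrightarrow>
    (\<exists>S. finite S \<and> S \<subseteq> B_rho H t r \<and>
      measure M {\<omega>\<in>space M. \<forall>s\<in>S. ?D \<omega> s t \<le> K * r / p} \<le> exp (- (p powr Q) / 2))"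
    using small_ball_component[OF assms(1,2,4,5,6,7), of ?i, folded assms(8)] by blast
  \<comment> \<open>The common engine of both bounds, with the net \<open>F\<close>, the dyadic
    scale \<open>q\<close> and the normalisation \<open>h\<close> still free. \<open>K / 8\<close>
    is the \<open>K / 2\<close> of the net argument divided by the 4 of the dyadic windows.\<close>
  have osc: "AE \<omega> in M. \<forall>\<^sub>F r in at_right 0. \<forall>t\<in>T0. \<exists>s\<in>B_rho H t r.
      K / 8 * \<beta> powr (- 1 / Q) \<le> ?D \<omega> s t / (r * h r powr (- 1 / Q))"
    if F: "\<And>m. finite (F m)" "\<And>m. F m \<subseteq> T" "\<And>m t. t \<in> T0 \<Longrightarrow> \<exists>t'\<in>F m. rho H t t' \<le> (1/2) ^ m"
      and q: "filterlim q at_top sequentially" "summable (\<lambda>m. real (card (F m)) * exp (- q m / 2))"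
      and \<beta>: "0 < \<beta>"
      and h: "\<forall>\<^sub>F m in sequentially. \<forall>r. 0 < r \<longrightarrow> r < 4 * (1/2) ^ m \<longrightarrow> 0 < q m \<and> q m \<le> \<beta> * h r"
    for F :: "nat \<Rightarrow> (real ^ 'n) set" and T0 q \<beta> h
  proof -
    have "AE \<omega> in M. \<forall>\<^sub>F m in sequentially. \<forall>t\<in>T0. \<exists>s\<in>B_rho H t (2 * (1/2) ^ m).
        K / 2 * (1/2) ^ m * q m powr (- 1 / Q) \<le> ?D \<omega> s t"
      by (rule AE_eventually_oscillation[where Z="\<lambda>t \<omega>. X t \<omega> $ ?i", OF M Z H Q r0 _ F q])
        (use SB in auto)
    then show ?thesis
    proof (rule AE_mp, intro AE_I2 impI)
      fix \<omega>
      assume "\<forall>\<^sub>F m in sequentially. \<forall>t\<in>T0. \<exists>s\<in>B_rho H t (2 * (1/2) ^ m).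
        K / 2 * (1/2) ^ m * q m powr (- 1 / Q) \<le> ?D \<omega> s t"
      from eventually_at_right_oscillation[OF this _ \<beta> Q h] K
      show "\<forall>\<^sub>F r in at_right 0. \<forall>t\<in>T0. \<exists>s\<in>B_rho H t r.
          K / 8 * \<beta> powr (- 1 / Q) \<le> ?D \<omega> s t / (r * h r powr (- 1 / Q))" by simp
    qed
  qed

  \<comment> \<open>Iterated-logarithm lower bound at a fixed point\<close>
  define C where "C = K / 8 * 8 powr (- 1 / Q)"
  have C: "0 < C" using K by (simp add: C_def)
  have 1: "AE \<omega> in M. Liminf (at_right 0) (\<lambda>r::real. SUP s\<in>B_rho H t r.
      ereal (norm (X s \<omega> - X t \<omega>) / (r * ln (ln (1 / r)) powr (- 1 / Q)))) \<ge> ereal C"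
    if t: "t \<in> T" for t
  proof -
    have "AE \<omega> in M. \<forall>\<^sub>F r in at_right 0. \<forall>t\<in>{t}. \<exists>s\<in>B_rho H t r.
      C \<le> ?D \<omega> s t / (r * ln (ln (1 / r)) powr (- 1 / Q))"
      unfolding C_def
    \<comment> \<open>One centre serves all levels, so it is enough that
      \<open>exp (- q m / 2)\<close>, here (m + 1)^(-2), is summable. Taking
      \<open>\<beta> = 8\<close>, twice the factor 4 in \<open>q\<close>, absorbs the gap between
      \<open>ln (real m + 1)\<close> and \<open>ln ((real m - 2) * ln 2)\<close> for large
      \<open>m\<close>.\<close>
    proof (rule osc[where F="\<lambda>_. {t}" and q="\<lambda>m. 4 * ln (real m + 1)"])
      show "filterlim (\<lambda>m. 4 * ln (real m + 1)) at_top sequentially" by real_asymp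
      have "exp (- (4 * ln (real m + 1)) / 2) = inverse (real (Suc m) ^ 2)" for m
      proof -
        have "exp (- (4 * ln (real m + 1)) / 2) = inverse (exp (2 * ln (real m + 1)))"
          by (simp add: exp_minus)
        also have "exp (2 * ln (real m + 1)) = real (Suc m) ^ 2"
          using exp_of_nat_mult[of 2 "ln (real m + 1)"] by (simp add: add.commute)
        finally show ?thesis .
      qed
      moreover have "summable (\<lambda>m. inverse (real (Suc m) ^ 2))"
        by (subst summable_Suc_iff[of "\<lambda>m. inverse (real m ^ 2)"]) (rule inverse_power_summable, simp)
      ultimately show "summable (\<lambda>m. real (card {t}) * exp (- (4 * ln (real m + 1)) / 2))" by simp
      have "\<forall>\<^sub>F m in sequentially. 0 < ln (real m + 1) \<and> 0 < (real m - 2) * ln 2 \<and>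
          4 * ln (real m + 1) \<le> 8 * ln ((real m - 2) * ln 2)"
        by (intro eventually_conj; real_asymp)
      then show "\<forall>\<^sub>F m in sequentially. \<forall>r. 0 < r \<longrightarrow> r < 4 * (1/2) ^ m \<longrightarrow>
          0 < 4 * ln (real m + 1) \<and> 4 * ln (real m + 1) \<le> 8 * ln (ln (1 / r))"
      proof eventually_elim
        case (elim m)
        show ?case
        proof (intro allI impI)
          fix r :: real assume "0 < r" "r < 4 * (1/2) ^ m"
          then have "(real m - 2) * ln 2 \<le> ln (1 / r)" by (rule ln_inverse_ge_of_less_dyadic)
          then have "ln ((real m - 2) * ln 2) \<le> ln (ln (1 / r))" using elim by (intro ln_mono) auto
          then show "0 < 4 * ln (real m + 1) \<and> 4 * ln (real m + 1) \<le> 8 * ln (ln (1 / r))"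
            using elim by linarith
        qed
      qed
    qed (use t in \<open>auto simp: rho_self\<close>)
    then show ?thesis
    proof (rule AE_mp, intro AE_I2 impI)
      fix \<omega>
      assume "\<forall>\<^sub>F r in at_right 0. \<forall>t\<in>{t}. \<exists>s\<in>B_rho H t r.
        C \<le> ?D \<omega> s t / (r * ln (ln (1 / r)) powr (- 1 / Q))"
      from Liminf_INF_SUP_ge[OF this D] show "ereal C \<le> Liminf (at_right 0) (\<lambda>r::real. SUP s\<in>B_rho H t r.
        ereal (norm (X s \<omega> - X t \<omega>) / (r * ln (ln (1 / r)) powr (- 1 / Q))))" by simp
    qed
  qed

  \<comment> \<open>Lower bound uniform over the interval\<close>
  have "bounded T" using assms(6) by (auto simp: bounded_interval_def)
  from finite_rho_net[OF H this] obtain C0 l where C0: "0 < C0" and l: "1 \<le> l"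
    and net: "\<forall>m::nat. \<exists>F. finite F \<and> F \<subseteq> T \<and>
      (\<forall>t\<in>T. \<exists>t'\<in>F. rho H t t' \<le> (1/2) ^ m) \<and> real (card F) \<le> C0 * l ^ m"
    by (elim exE conjE) (rule that)
  from choice[OF net] obtain F where
    "\<forall>m. finite (F m) \<and> F m \<subseteq> T \<and>
      (\<forall>t\<in>T. \<exists>t'\<in>F m. rho H t t' \<le> (1/2) ^ m) \<and> real (card (F m)) \<le> C0 * l ^ m" ..
  then have F: "\<And>m. finite (F m)" "\<And>m. F m \<subseteq> T"
      "\<And>m t. t \<in> T \<Longrightarrow> \<exists>t'\<in>F m. rho H t t' \<le> (1/2) ^ m" "\<And>m. real (card (F m)) \<le> C0 * l ^ m"
    by simp_all
  \<comment> \<open>Makes exp(- A m / 2) equal to (2 l)^(-m): the factor \<open>l\<close> cancels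
    the growth of the net, and the 2 leaves a convergent geometric series.\<close>
  define A where "A = 2 * ln (2 * l)"
  have A: "0 < A" using l by (simp add: A_def)
  \<comment> \<open>The 3 comes from m <= 3 (m - 2) for m >= 3, and \<open>ln 2\<close> from
    \<open>(real m - 2) * ln 2 \<le> ln (1 / r)\<close>.\<close>
  define \<beta> where "\<beta> = 3 * A / ln 2"
  have \<beta>: "0 < \<beta>" using A by (simp add: \<beta>_def)
  define C' where "C' = K / 8 * \<beta> powr (- 1 / Q)"
  have C': "0 < C'" using K \<beta> by (simp add: C'_def)
  have ev: "AE \<omega> in M. \<forall>\<^sub>F r in at_right 0. \<forall>t\<in>T. \<exists>s\<in>B_rho H t r.
      C' \<le> ?D \<omega> s t / (r * ln (1 / r) powr (- 1 / Q))"
    unfolding C'_def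
  proof (rule osc[OF F(1,2,3) _ _ \<beta>])
    show "filterlim (\<lambda>m. A * real m) at_top sequentially" using A by real_asymp
    show "summable (\<lambda>m. real (card (F m)) * exp (- (A * real m) / 2))"
    proof (rule summable_comparison_test)
      show "summable (\<lambda>m. C0 * (1/2) ^ m)" by (intro summable_mult summable_geometric) simp
      show "\<exists>N. \<forall>m\<ge>N. norm (real (card (F m)) * exp (- (A * real m) / 2)) \<le> C0 * (1/2) ^ m"
      proof (intro exI allI impI)
        fix m
        have "exp (- (A * real m) / 2) = exp (- ln (2 * l)) ^ m"
          by (simp add: A_def exp_of_nat_mult[symmetric] mult.commute)
        also have "\<dots> = (1 / (2 * l)) ^ m" using l by (simp add: exp_minus inverse_eq_divide)
        finally have e: "exp (- (A * real m) / 2) = (1 / (2 * l)) ^ m" .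
        have "real (card (F m)) * exp (- (A * real m) / 2) \<le> C0 * l ^ m * (1 / (2 * l)) ^ m"
          unfolding e using F(4) l by (intro mult_right_mono) auto
        also have "\<dots> = C0 * (1/2) ^ m"
          using l by (simp add: power_mult_distrib[symmetric] mult.assoc)
        finally show "norm (real (card (F m)) * exp (- (A * real m) / 2)) \<le> C0 * (1/2) ^ m" by simp
      qed
    qed
    show "\<forall>\<^sub>F m in sequentially. \<forall>r. 0 < r \<longrightarrow> r < 4 * (1/2) ^ m \<longrightarrow>
        0 < A * real m \<and> A * real m \<le> \<beta> * ln (1 / r)"
      using eventually_ge_at_top[of 3]
    proof eventually_elim
      case (elim m)
      show ?case
      proof (intro allI impI conjI)
        fix r :: real assume r: "0 < r" "r < 4 * (1/2) ^ m"
        show "0 < A * real m" using A elim by simp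
        have "A * real m \<le> A * (3 * (real m - 2))" using A elim by (intro mult_left_mono) auto
        also have "\<dots> = \<beta> * ((real m - 2) * ln 2)" by (simp add: \<beta>_def)
        also have "\<dots> \<le> \<beta> * ln (1 / r)"
          using \<beta> by (intro mult_left_mono ln_inverse_ge_of_less_dyadic[OF r]) auto
        finally show "A * real m \<le> \<beta> * ln (1 / r)" .
      qed
    qed
  qed
  have 2: "AE \<omega> in M. Liminf (at_right 0) (\<lambda>r::real. INF t\<in>T. SUP s\<in>B_rho H t r.
      ereal (norm (X s \<omega> - X t \<omega>) / (r * ln (1 / r) powr (- 1 / Q)))) \<ge> ereal C'"
    using ev by eventually_elim (rule Liminf_INF_SUP_ge[OF _ D], auto)

  \<comment> \<open>Nowhere differentiability\<close>
  have 3: "AE \<omega> in M. \<forall>t\<in>T. \<not> (\<lambda>s. X s \<omega>) differentiable (at t)"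
    \<comment> \<open>The uniform event is used because the exceptional null set of the pointwise
      bound depends on \<open>t\<close>, and uncountably many null sets cannot be united.\<close>
    using ev
  proof eventually_elim
    case (elim \<omega>)
    show ?case
    proof
      fix t assume t: "t \<in> T"
      from elim eventually_at_right_less[of 0]
      have "\<forall>\<^sub>F r in at_right 0. \<exists>s\<in>B_rho H t r.
          C' \<le> norm (X s \<omega> - X t \<omega>) / (r * ln (1 / r) powr (- 1 / Q))"
      proof eventually_elim
        case (elim r)
        then obtain s where s: "s \<in> B_rho H t r" "C' \<le> ?D \<omega> s t / (r * ln (1 / r) powr (- 1 / Q))"
          using t by blast
        have "?D \<omega> s t / (r * ln (1 / r) powr (- 1 / Q)) \<le> norm (X s \<omega> - X t \<omega>) / (r * ln (1 / r) powr (- 1 / Q))"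
          using D elim(2) by (intro divide_right_mono) auto
        then show ?case using s by (intro bexI[of _ s]) linarith+
      qed
      then show "\<not> (\<lambda>s. X s \<omega>) differentiable (at t)"
        by (rule not_differentiable_of_oscillation[OF H C' Q])
    qed
  qed
  from 1 2 3 C C' show ?thesis by blast
qed

end
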